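(* Over any field $\mathbb{F}$, $\mathbf{VP}_2^{\mathrm{weak}}\subsetneq\mathbf{VP}_2^{\mathrm{gen}}$.
   Context: An algebraic branching program (ABP) over $\mathbb{F}$ is a DAG with source $s$ and sink $t$, vertices assigned to layers, edges going from layer $i$ to layer $i+1$ and labelled by affine linear forms; width = max layer size, size = number of vertices, value = sum over $s$-$t$ paths of the products of edge labels. A weak ABP has edge labels of the form $\alpha x_i+\beta$ with $\alpha,\beta\in\mathbb{F}$; a general ABP allows arbitrary affine linear forms $\sum_i\alpha_ix_i+\beta$. $\mathbf{VP}_2^{\mathrm{weak}}$ (resp. $\mathbf{VP}_2^{\mathrm{gen}}$) is the class of families of polynomials (in polynomially many variables) computable by polynomial-size width-2 weak (resp. general) ABPs. *)

theory Defs
  imports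
    "HOL-Library.Poly_Mapping"
    "HOL-Computational_Algebra.Polynomial"
    "Graph_Theory.Pair_Digraph"
begin

text \<open>
  Formal multivariate polynomials in the variables \<open>x\<^sub>0, x\<^sub>1, \<dots>\<close>: a monomial is a finitely
  supported exponent vector, a polynomial a finitely supported family of coefficients indexed
  by monomials. The multiplication of \<^typ>\<open>(nat \<Rightarrow>\<^sub>0 nat) \<Rightarrow>\<^sub>0 'a::semiring_0\<close> is the convolution
  product, that is, the product of polynomials.
\<close>

type_synonym 'a mpoly = "(nat \<Rightarrow>\<^sub>0 nat) \<Rightarrow>\<^sub>0 'a"

definition Const :: "'a::zero \<Rightarrow> 'a mpoly" where
  "Const c = Poly_Mapping.single 0 c"

definition Var :: "nat \<Rightarrow> 'a::zero_neq_one mpoly" where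
  "Var i = Poly_Mapping.single (Poly_Mapping.single i 1) 1"

definition vars :: "'a::zero mpoly \<Rightarrow> nat set" where
  "vars p = (\<Union>m \<in> Poly_Mapping.keys p. Poly_Mapping.keys m)"

definition general_labels :: "nat \<Rightarrow> 'a::field mpoly set" where
  "general_labels m = {(\<Sum>i<m. Const (\<alpha> i) * Var i) + Const \<beta> | \<alpha> \<beta>. True}"

text \<open>The constants are listed separately only for the sake of \<open>m = 0\<close>.\<close>

definition weak_labels :: "nat \<Rightarrow> 'a::field mpoly set" where
  "weak_labels m = {Const \<alpha> * Var i + Const \<beta> | \<alpha> i \<beta>. i < m} \<union> range Const"

text \<open>
  Arcs are pairs of vertices, so there are no parallel arcs; with parallel arcs, weak labels
  would already simulate arbitrary affine linear forms. Any finite vertex set can be encoded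
  as a set of natural numbers.
\<close>

record (overloaded) 'a::zero abp =
  graph :: "nat pair_pre_digraph"
  layer :: "nat \<Rightarrow> nat"
  label :: "nat \<times> nat \<Rightarrow> 'a mpoly"
  source :: nat
  sink :: nat

text \<open>Acyclicity of the graph follows from the condition on the layers.\<close>

definition is_abp :: "'a mpoly set \<Rightarrow> 'a::field abp \<Rightarrow> bool" where
  "is_abp L A \<longleftrightarrow>
     pair_fin_digraph (graph A) \<and>
     source A \<in> pverts (graph A) \<and> sink A \<in> pverts (graph A) \<and>
     (\<forall>(u, v) \<in> parcs (graph A). layer A v = layer A u + 1) \<and>
     (\<forall>e \<in> parcs (graph A). label A e \<in> L)"

definition abp_width :: "'a::zero abp \<Rightarrow> nat" where
  "abp_width A =
     Max ((\<lambda>i. card {v \<in> pverts (graph A). layer A v = i}) ` layer A ` pverts (graph A))"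

definition abp_size :: "'a::zero abp \<Rightarrow> nat" where
  "abp_size A = card (pverts (graph A))"

definition abp_value :: "'a::field abp \<Rightarrow> 'a mpoly" where
  "abp_value A =
     (\<Sum>p | pre_digraph.apath (with_proj (graph A)) (source A) p (sink A).
        prod_list (map (label A) p))"

definition poly_bounded :: "(nat \<Rightarrow> nat) \<Rightarrow> bool" where
  "poly_bounded t \<longleftrightarrow> (\<exists>q :: nat poly. \<forall>n. t n \<le> poly q n)"

text \<open>
  The families \<open>f\<close> with \<open>f n\<close> a polynomial in the variables \<open>x\<^sub>0, \<dots>, x\<^bsub>m n - 1\<^esub>\<close>, where \<open>m\<close> is
  polynomially bounded, such that \<open>f n\<close> is computed over these variables by a branching program
  of width at most \<open>k\<close> and of size polynomially bounded in \<open>n\<close>. The set \<open>L m\<close> contains the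
  labels allowed over \<open>m\<close> variables.
\<close>

definition abp_class :: "(nat \<Rightarrow> 'a mpoly set) \<Rightarrow> nat \<Rightarrow> (nat \<Rightarrow> 'a::field mpoly) set" where
  "abp_class L k = {f. \<exists>m s. poly_bounded m \<and> poly_bounded s \<and>
     (\<forall>n. vars (f n) \<subseteq> {..<m n} \<and>
        (\<exists>A. is_abp (L (m n)) A \<and> abp_width A \<le> k \<and> abp_size A \<le> s n \<and> abp_value A = f n))}"

definition VP2_weak :: "(nat \<Rightarrow> 'a::field mpoly) set" where
  "VP2_weak = abp_class weak_labels 2"

definition VP2_gen :: "(nat \<Rightarrow> 'a::field mpoly) set" where
  "VP2_gen = abp_class general_labels 2"

end

theory Submission
  imports Defs "HOL-Algebra.Algebraic_Closure_Type"
begin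

text \<open>
  The polynomial \<open>f = (x\<^sub>0 + \<dots> + x\<^sub>8)\<^sup>2 + y\<^sub>0 + \<dots> + y\<^sub>8\<close> separates the classes. A weak program of
  width two is a product of \<open>2 \<times> 2\<close> matrices, each involving at most four variables. Work over the
  algebraic closure. Fixing the variables of one matrix so that it becomes singular factors \<open>f\<close>,
  which remains irreducible because it is still \<open>y + q\<close> for some variable \<open>y\<close>; so the product up
  to that matrix, or the product from that matrix on, becomes constant. Take the longest prefix
  that becomes constant in this way and the next matrix that can still be made singular: after
  fixing at most eight variables, \<open>f\<close> is computed by matrices whose determinants never vanish,
  hence are constant. Such matrices are products of constant matrices and one elementary matrix.
  By Cohn's normal form for products of elementary matrices, the entries of their products are,
  up to constants, continuants \<open>K(z\<^sub>1, \<dots>, z\<^sub>n)\<close> of nonconstant affine forms, of degree \<open>n\<close>.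
  But \<open>f\<close> specialises to \<open>X\<^sup>2 + Y\<close>, which is not of the form \<open>\<mu> (z\<^sub>1 z\<^sub>2 + 1)\<close>.
\<close>

hide_const (open) Polynomials.degree up_ring.coeff

section \<open>Evaluation of polynomials\<close>

definition mon_eval :: "(nat \<Rightarrow> 'b::comm_semiring_1) \<Rightarrow> (nat \<Rightarrow>\<^sub>0 nat) \<Rightarrow> 'b" where
  "mon_eval p m = (\<Prod>i\<in>Poly_Mapping.keys m. p i ^ Poly_Mapping.lookup m i)"

lemma mon_eval_superset:
  assumes "finite I" "Poly_Mapping.keys m \<subseteq> I"
  shows "mon_eval p m = (\<Prod>i\<in>I. p i ^ Poly_Mapping.lookup m i)"
  unfolding mon_eval_def using assms
  by (intro prod.mono_neutral_left) (auto simp: in_keys_iff)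

lemma mon_eval_add: "mon_eval p (m + n) = mon_eval p m * mon_eval p n"
proof -
  define I where "I = Poly_Mapping.keys m \<union> Poly_Mapping.keys n"
  have "finite I" "Poly_Mapping.keys m \<subseteq> I" "Poly_Mapping.keys n \<subseteq> I"
    "Poly_Mapping.keys (m + n) \<subseteq> I"
    using Poly_Mapping.keys_add[of m n] by (auto simp: I_def)
  then show ?thesis
    by (simp add: mon_eval_superset[of I] lookup_add power_add prod.distrib)
qed

text \<open>Coefficients pass through \<open>\<phi>\<close>, so that a polynomial over a field can
  be evaluated at points over its algebraic closure.\<close>

definition mpoly_eval :: "('a::comm_semiring_1 \<Rightarrow> 'b::comm_semiring_1) \<Rightarrow> (nat \<Rightarrow> 'b) \<Rightarrow> 'a mpoly \<Rightarrow> 'b" where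
  "mpoly_eval \<phi> p f = (\<Sum>m\<in>Poly_Mapping.keys f. \<phi> (Poly_Mapping.lookup f m) * mon_eval p m)"

locale semiring_hom =
  fixes \<phi> :: "'a::comm_semiring_1 \<Rightarrow> 'b::comm_semiring_1"
  assumes hom_zero [simp]: "\<phi> 0 = 0" and hom_one [simp]: "\<phi> 1 = 1"
    and hom_add: "\<phi> (x + y) = \<phi> x + \<phi> y" and hom_mult: "\<phi> (x * y) = \<phi> x * \<phi> y"
begin

lemma mpoly_eval_superset:
  assumes "finite A" "Poly_Mapping.keys f \<subseteq> A"
  shows "mpoly_eval \<phi> p f = (\<Sum>m\<in>A. \<phi> (Poly_Mapping.lookup f m) * mon_eval p m)"
  unfolding mpoly_eval_def using assms
  by (intro sum.mono_neutral_left) (auto simp: in_keys_iff)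

lemma mpoly_eval_add: "mpoly_eval \<phi> p (f + g) = mpoly_eval \<phi> p f + mpoly_eval \<phi> p g"
proof -
  define A where "A = Poly_Mapping.keys f \<union> Poly_Mapping.keys g"
  have "finite A" "Poly_Mapping.keys f \<subseteq> A" "Poly_Mapping.keys g \<subseteq> A"
    "Poly_Mapping.keys (f + g) \<subseteq> A"
    using Poly_Mapping.keys_add[of f g] by (auto simp: A_def)
  then show ?thesis
    by (simp add: mpoly_eval_superset[of A] lookup_add hom_add distrib_right sum.distrib)
qed

lemma mpoly_eval_zero [simp]: "mpoly_eval \<phi> p 0 = 0"
  by (simp add: mpoly_eval_def)

lemma mpoly_eval_sum: "mpoly_eval \<phi> p (\<Sum>i\<in>I. f i) = (\<Sum>i\<in>I. mpoly_eval \<phi> p (f i))"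
  by (induction I rule: infinite_finite_induct) (simp_all add: mpoly_eval_add)

lemma mpoly_eval_single: "mpoly_eval \<phi> p (Poly_Mapping.single m c) = \<phi> c * mon_eval p m"
  by (cases "c = 0") (simp_all add: mpoly_eval_def)

lemma mpoly_eval_mult: "mpoly_eval \<phi> p (f * g) = mpoly_eval \<phi> p f * mpoly_eval \<phi> p g"
proof -
  have sum: "(\<Sum>m\<in>Poly_Mapping.keys f. Poly_Mapping.single m (Poly_Mapping.lookup f m)) = f" for f :: "'a mpoly"
    by (rule poly_mapping_eqI) (auto simp: lookup_sum lookup_single when_def in_keys_iff)
  have "mpoly_eval \<phi> p (f * g) =
    mpoly_eval \<phi> p ((\<Sum>m\<in>Poly_Mapping.keys f. Poly_Mapping.single m (Poly_Mapping.lookup f m)) *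
      (\<Sum>n\<in>Poly_Mapping.keys g. Poly_Mapping.single n (Poly_Mapping.lookup g n)))"
    by (simp only: sum)
  also have "\<dots> = mpoly_eval \<phi> p f * mpoly_eval \<phi> p g"
    by (simp add: sum_product mpoly_eval_sum mult_single mpoly_eval_single hom_mult mon_eval_add)
      (simp add: mpoly_eval_def sum_product mult_ac)
  finally show ?thesis .
qed

lemma mpoly_eval_Const [simp]: "mpoly_eval \<phi> p (Const c) = \<phi> c"
  by (simp add: Const_def mpoly_eval_single mon_eval_def)

lemma mpoly_eval_one [simp]: "mpoly_eval \<phi> p 1 = 1"
  using mpoly_eval_Const[of p 1] by (simp add: Const_def)

lemma mpoly_eval_Var [simp]: "mpoly_eval \<phi> p (Var i) = p i"
  by (simp add: Var_def mpoly_eval_single mon_eval_def)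

end

section \<open>Irreducibility along planes\<close>

text \<open>Euclid's argument: over a finite field the product of all \<open>x - a\<close>,
  increased by 1, would have no root.\<close>

lemma infinite_UNIV_alg_closed: "infinite (UNIV :: 'a::alg_closed_field set)"
proof
  assume fin: "finite (UNIV :: 'a set)"
  define q :: "'a poly" where "q = (\<Prod>a\<in>UNIV. [:-a, 1:])"
  have "degree q = card (UNIV :: 'a set)"
    unfolding q_def by (subst degree_prod_eq_sum_degree) auto
  with fin have "degree q > 0"
    by (simp add: card_gt_0_iff)
  then have "degree (q + 1) > 0"
    by (subst degree_add_eq_left) auto
  then obtain x where "poly (q + 1) x = 0"
    using alg_closed_imp_poly_has_root by blast
  moreover have "poly q x = 0"
    unfolding q_def poly_prod using fin by (auto intro!: prod_zero)
  ultimately show False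
    by simp
qed

text \<open>Bivariate polynomials are iterated univariate ones: the outer variable takes the value
  \<open>t\<close>, the inner one \<open>s\<close>.\<close>

definition eval2 :: "'a::comm_ring_1 poly poly \<Rightarrow> 'a \<Rightarrow> 'a \<Rightarrow> 'a" where
  "eval2 G s t = poly (poly G [:t:]) s"

lemma eval2_simps [simp]:
  "eval2 (G + H) s t = eval2 G s t + eval2 H s t"
  "eval2 (G * H) s t = eval2 G s t * eval2 H s t"
  "eval2 0 s t = 0"
  "eval2 1 s t = 1"
  "eval2 (pCons a G) s t = poly a s + t * eval2 G s t"
  by (simp_all add: eval2_def)

lemma poly_eq_if_infinite:
  fixes p q :: "'a::idom poly"
  assumes "infinite A" "\<And>x. x \<in> A \<Longrightarrow> poly p x = poly q x"
  shows "p = q"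
proof (rule ccontr)
  assume "p \<noteq> q"
  then have "finite {x. poly (p - q) x = 0}"
    by (intro poly_roots_finite) simp
  moreover have "A \<subseteq> {x. poly (p - q) x = 0}"
    using assms(2) by auto
  ultimately show False
    using assms(1) finite_subset by blast
qed

lemma eval2_inject:
  fixes G H :: "'a::idom poly poly"
  assumes inf: "infinite (UNIV :: 'a set)" and eq: "\<And>s t. eval2 G s t = eval2 H s t"
  shows "G = H"
proof (rule poly_eq_if_infinite)
  show "infinite (range (\<lambda>t::'a. [:t:]))"
    using inf by (subst finite_image_iff) (auto simp: inj_on_def)
  show "poly G x = poly H x" if "x \<in> range (\<lambda>t. [:t:])" for x
    using that poly_eq_if_infinite[OF inf, of "poly G x" "poly H x"] eq
    by (auto simp: eval2_def)
qed

text \<open>Degrees in the outer variable add up to 1, so one factor has degree 0. It divides the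
  leading coefficient 1 of the product and is therefore a unit, that is, a constant.\<close>

lemma monic_linear_factors:
  fixes G H :: "'a::field poly poly"
  assumes GH: "G * H = [:c, 1:]"
  shows "(\<exists>k. G = [:[:k:]:]) \<or> (\<exists>k. H = [:[:k:]:])"
proof -
  have *: "\<exists>k. Q = [:[:k:]:]" if PQ: "P * Q = [:c, 1:]" and deg: "degree Q = 0" for P Q :: "'a poly poly"
  proof -
    obtain q where q: "Q = [:q:]"
      using degree_eq_zeroE[OF deg] by blast
    have "coeff (P * Q) 1 = q * coeff P 1"
      unfolding q by (simp add: mult.commute)
    then have "q * coeff P 1 = 1"
      unfolding PQ by simp
    then have "q dvd 1"
      by (metis dvd_triv_left)
    then show ?thesis
      using q by (auto simp: is_unit_poly_iff)
  qed
  have "G \<noteq> 0" "H \<noteq> 0"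
    using GH by auto
  then have "degree G + degree H = degree (G * H)"
    by (simp add: degree_mult_eq)
  also have "\<dots> = 1"
    unfolding GH by simp
  finally have "degree G = 0 \<or> degree H = 0"
    by linarith
  moreover have "H * G = [:c, 1:]"
    using GH by (simp only: mult.commute)
  ultimately show ?thesis
    using *[OF GH] *[of H G] by blast
qed

text \<open>Functions instead of formal polynomials: what matters is closure under the operations
  and that restriction to a plane gives a bivariate polynomial.\<close>

inductive polyfun :: "((nat \<Rightarrow> 'a::comm_ring_1) \<Rightarrow> 'a) \<Rightarrow> bool" where
  const: "polyfun (\<lambda>p. c)"
| var: "polyfun (\<lambda>p. p i)"
| add: "polyfun g \<Longrightarrow> polyfun h \<Longrightarrow> polyfun (\<lambda>p. g p + h p)"
| mult: "polyfun g \<Longrightarrow> polyfun h \<Longrightarrow> polyfun (\<lambda>p. g p * h p)"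

lemma polyfun_sum:
  "(\<And>i. i \<in> I \<Longrightarrow> polyfun (g i)) \<Longrightarrow> polyfun (\<lambda>p. \<Sum>i\<in>I. g i p)"
  by (induction I rule: infinite_finite_induct) (auto intro: polyfun.intros)

lemma polyfun_power: "polyfun g \<Longrightarrow> polyfun (\<lambda>p. g p ^ n)"
  by (induction n) (auto intro: polyfun.intros)

lemma polyfun_eval2:
  assumes "polyfun g"
  shows "\<exists>G. \<forall>s t. g (\<lambda>i. eval2 (P i) s t) = eval2 G s t"
  using assms
proof induction
  case (const c)
  show ?case by (intro exI[of _ "[:[:c:]:]"]) simp
next
  case (var i)
  show ?case by auto
next
  case (add g h)
  then obtain G H where "\<forall>s t. g (\<lambda>i. eval2 (P i) s t) = eval2 G s t"
    "\<forall>s t. h (\<lambda>i. eval2 (P i) s t) = eval2 H s t" by auto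
  then show ?case by (intro exI[of _ "G + H"]) simp
next
  case (mult g h)
  then obtain G H where "\<forall>s t. g (\<lambda>i. eval2 (P i) s t) = eval2 G s t"
    "\<forall>s t. h (\<lambda>i. eval2 (P i) s t) = eval2 H s t" by auto
  then show ?case by (intro exI[of _ "G * H"]) simp
qed

definition agree :: "(nat \<Rightarrow> 'a) \<Rightarrow> nat set \<Rightarrow> (nat \<Rightarrow> 'a) set" where
  "agree \<tau> S = {p. \<forall>i\<in>S. p i = \<tau> i}"

text \<open>The plane through \<open>p\<close> and \<open>p'\<close> in the direction of
  \<open>y\<close> stays inside the subspace. On it \<open>f\<close> is monic of degree one in the
  parameter \<open>t\<close>, so one factor is constant there, in particular at \<open>p\<close>, at
  \<open>p'\<close> and one step from \<open>p\<close> along \<open>y\<close>.\<close>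

lemma factor_dichotomy_plane:
  fixes f g h :: "(nat \<Rightarrow> 'a::field) \<Rightarrow> 'a"
  assumes inf: "infinite (UNIV :: 'a set)"
    and poly: "polyfun f" "polyfun g" "polyfun h"
    and shift: "\<And>p t. f (p(y := p y + t)) = f p + t"
    and eq: "\<And>p. p \<in> agree \<tau> S \<Longrightarrow> f p = g p * h p"
    and "y \<notin> S" "p \<in> agree \<tau> S" "p' \<in> agree \<tau> S"
  shows "(g p' = g p \<and> g (p(y := p y + 1)) = g p) \<or> (h p' = h p \<and> h (p(y := p y + 1)) = h p)"
proof -
  define P where "P = (\<lambda>i. [:[:p i, p' i - p i:], if i = y then 1 else 0:])"
  define pt where "pt = (\<lambda>s t i. eval2 (P i) s t)"
  have pt: "pt s t i = p i + s * (p' i - p i) + (if i = y then t else 0)" for s t i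
    by (simp add: pt_def P_def)
  have agr: "pt s t \<in> agree \<tau> S" for s t
    using assms(7-9) by (auto simp: agree_def pt)
  obtain C G H where rep: "\<And>s t. f (pt s t) = eval2 C s t" "\<And>s t. g (pt s t) = eval2 G s t"
    "\<And>s t. h (pt s t) = eval2 H s t"
    using polyfun_eval2[OF poly(1), of P] polyfun_eval2[OF poly(2), of P]
      polyfun_eval2[OF poly(3), of P] unfolding pt_def by auto
  have "pt s t = (pt s 0)(y := pt s 0 y + t)" for s t
    by (auto simp: pt fun_eq_iff)
  then have sum: "f (pt s t) = f (pt s 0) + t" for s t
    using shift by metis
  have "f (pt s t) = eval2 [:poly C 0, 1:] s t" for s t
    using rep(1)[of s 0] unfolding sum[of s t] by (simp add: eval2_def)
  then have "eval2 (G * H) s t = eval2 [:poly C 0, 1:] s t" for s t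
    using eq[OF agr, of s t] rep(2,3)[of s t] by simp
  then have "G * H = [:poly C 0, 1:]"
    by (intro eval2_inject[OF inf]) auto
  then consider k where "G = [:[:k:]:]" | k where "H = [:[:k:]:]"
    using monic_linear_factors by blast
  moreover have "pt 0 0 = p" "pt 1 0 = p'" "pt 0 1 = p(y := p y + 1)"
    by (auto simp: pt fun_eq_iff)
  ultimately show ?thesis
    using rep(2,3)[of 0 0] rep(2,3)[of 1 0] rep(2,3)[of 0 1] by cases auto
qed

text \<open>
  A polynomial of the form \<open>y + q\<close>, with \<open>q\<close> free of \<open>y\<close>, is irreducible, and it stays so
  when variables other than \<open>y\<close> are fixed.
\<close>

lemma factor_dichotomy:
  fixes f g h :: "(nat \<Rightarrow> 'a::field) \<Rightarrow> 'a"
  assumes inf: "infinite (UNIV :: 'a set)"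
    and poly: "polyfun f" "polyfun g" "polyfun h"
    and shift: "\<And>p t. f (p(y := p y + t)) = f p + t"
    and eq: "\<And>p. p \<in> agree \<tau> S \<Longrightarrow> f p = g p * h p"
    and "y \<notin> S"
  shows "(\<forall>p \<in> agree \<tau> S. g p = g \<tau>) \<or> (\<forall>p \<in> agree \<tau> S. h p = h \<tau>)"
proof -
  have \<tau>: "\<tau> \<in> agree \<tau> S" "\<tau>(y := \<tau> y + 1) \<in> agree \<tau> S"
    using \<open>y \<notin> S\<close> by (auto simp: agree_def)
  have "f \<tau> \<noteq> f (\<tau>(y := \<tau> y + 1))"
    using shift[of \<tau> 1] by simp
  \<comment> \<open>The factor that changes along \<open>y\<close> at \<open>\<tau>\<close> is not
    the constant one on any of the planes through \<open>\<tau>\<close>, so the same alternative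
    holds for every \<open>p'\<close>.\<close>
  then have "g (\<tau>(y := \<tau> y + 1)) \<noteq> g \<tau> \<or> h (\<tau>(y := \<tau> y + 1)) \<noteq> h \<tau>"
    using eq \<tau> by metis
  then show ?thesis
    using factor_dichotomy_plane[OF assms \<tau>(1)] by blast
qed

section \<open>Cohn's standard form\<close>

definition cst :: "'a::comm_ring_1 \<Rightarrow> 'a poly poly" where
  "cst k = [:[:k:]:]"

lemma cst_simps:
  "cst (a + b) = cst a + cst b" "cst (a - b) = cst a - cst b"
  "cst (a * b) = cst a * cst b" "cst (- a) = - cst a"
  "cst 0 = 0" "cst 1 = 1"
  by (simp_all add: cst_def one_pCons)

lemma cst_divide: "m \<noteq> 0 \<Longrightarrow> cst m * cst (l / m) = cst (l::'a::field)"
  by (simp flip: cst_simps)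

lemma cst_divide_left: "m \<noteq> 0 \<Longrightarrow> cst m * (cst (l / m) * c) = cst (l::'a::field) * c"
  by (simp add: cst_divide flip: mult.assoc)

lemma eval2_cst [simp]: "eval2 (cst k) s t = k"
  by (simp add: cst_def)

text \<open>With \<open>t\<close> the outer and \<open>w\<close> the inner variable, the form \<open>\<gamma> + \<alpha> t + \<beta> w t\<close>.\<close>

definition aff :: "'a::comm_ring_1 \<Rightarrow> 'a \<Rightarrow> 'a \<Rightarrow> 'a poly poly" where
  "aff \<gamma> \<alpha> \<beta> = [:[:\<gamma>:], [:\<alpha>, \<beta>:]:]"

text \<open>Because both linear parts carry the factor \<open>t\<close>, each such form has degree
  exactly one in \<open>t\<close>.\<close>

definition nonconst_aff :: "'a::comm_ring_1 poly poly \<Rightarrow> bool" where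
  "nonconst_aff z \<longleftrightarrow> (\<exists>\<gamma> \<alpha> \<beta>. z = aff \<gamma> \<alpha> \<beta> \<and> (\<alpha> \<noteq> 0 \<or> \<beta> \<noteq> 0))"

lemma aff_cases:
  obtains "nonconst_aff (aff \<gamma> \<alpha> \<beta>)" | "aff \<gamma> \<alpha> \<beta> = cst \<gamma>"
  by (cases "\<alpha> = 0 \<and> \<beta> = 0") (auto simp: nonconst_aff_def aff_def cst_def)

lemma aff_add: "aff \<gamma> \<alpha> \<beta> + aff \<gamma>' \<alpha>' \<beta>' = aff (\<gamma> + \<gamma>') (\<alpha> + \<alpha>') (\<beta> + \<beta>')"
  by (simp add: aff_def)

lemma aff_cst: "cst \<gamma> = aff \<gamma> 0 0"
  by (simp add: aff_def cst_def)

lemma aff_mult: "cst k * aff \<gamma> \<alpha> \<beta> = aff (k * \<gamma>) (k * \<alpha>) (k * \<beta>)"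
  by (simp add: aff_def cst_def)

lemma nonconst_aff_add_cst: "nonconst_aff z \<Longrightarrow> nonconst_aff (z + cst k)"
  unfolding nonconst_aff_def aff_cst by (metis aff_add add.right_neutral)

text \<open>The pair consists of the continuants of the tail and of the whole list, in the
  convention with plus signs.\<close>

fun continuant :: "'a::comm_ring_1 list \<Rightarrow> 'a \<times> 'a" where
  "continuant [] = (0, 1)"
| "continuant (z # zs) = (snd (continuant zs), fst (continuant zs) + z * snd (continuant zs))"

text \<open>The constant is added to the first form of the list, whose coefficient in
  \<open>d\<close> is \<open>c\<close>; for the empty list \<open>c\<close> is 0.\<close>

lemma continuant_absorb:
  assumes "\<forall>z\<in>set zs. nonconst_aff z" "continuant zs = (c, d)"
  shows "\<exists>zs'. (\<forall>z\<in>set zs'. nonconst_aff z) \<and> continuant zs' = (c, d + cst k * c)"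
proof (cases zs)
  case Nil
  then show ?thesis
    using assms by (intro exI[of _ "[]"]) auto
next
  case (Cons z zs1)
  then show ?thesis
    using assms nonconst_aff_add_cst[of z k]
    by (intro exI[of _ "(z + cst k) # zs1"]) (auto simp: algebra_simps)
qed

text \<open>
  Cohn's standard form for rows of products of elementary matrices over a polynomial ring,
  up to an invertible constant matrix; the two disjuncts are the two Bruhat cells.
\<close>

definition std_row :: "'a::field poly poly \<Rightarrow> 'a poly poly \<Rightarrow> bool" where
  "std_row x y \<longleftrightarrow> (\<exists>zs c d k l m. (\<forall>z\<in>set zs. nonconst_aff z) \<and> continuant zs = (c, d) \<and>
     k \<noteq> 0 \<and> l \<noteq> 0 \<and>
     (x = cst k * d \<and> y = cst l * c + cst m * d \<or> x = cst k * c \<and> y = cst l * d))"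

text \<open>The row is \<open>(c, d)\<close> times an invertible constant matrix. Whether
  \<open>k3\<close> vanishes decides the Bruhat cell, and the unipotent part is absorbed into the
  first argument of the continuant.\<close>

lemma std_row_combination:
  assumes zs: "\<forall>z\<in>set zs. nonconst_aff z" "continuant zs = (c, d)"
    and det: "k1 * k4 - k2 * k3 \<noteq> (0::'a::field)"
  shows "std_row (cst k1 * c + cst k3 * d) (cst k2 * c + cst k4 * d)"
proof (cases "k3 = 0")
  case True
  then have nz: "k1 \<noteq> 0" "k4 \<noteq> 0"
    using det by auto
  obtain zs' where zs': "\<forall>z\<in>set zs'. nonconst_aff z" "continuant zs' = (c, d + cst (k2 / k4) * c)"
    using continuant_absorb[OF zs] by blast
  have "cst k1 * c + cst k3 * d = cst k1 * c"
    using True by (simp add: cst_simps)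
  moreover have "cst k2 * c + cst k4 * d = cst k4 * (d + cst (k2 / k4) * c)"
    using nz by (simp add: distrib_left cst_divide_left)
  ultimately show ?thesis
    unfolding std_row_def using zs' nz by blast
next
  case False
  obtain zs' where zs': "\<forall>z\<in>set zs'. nonconst_aff z" "continuant zs' = (c, d + cst (k1 / k3) * c)"
    using continuant_absorb[OF zs] by blast
  have "k2 - k4 * (k1 / k3) \<noteq> 0"
    using det False by (simp add: field_simps)
  moreover have "cst k1 * c + cst k3 * d = cst k3 * (d + cst (k1 / k3) * c)"
    using False by (simp add: distrib_left cst_divide_left)
  moreover have "cst k2 * c + cst k4 * d =
      cst (k2 - k4 * (k1 / k3)) * c + cst k4 * (d + cst (k1 / k3) * c)"
    by (simp only: cst_simps) Groebner_Basis.algebra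
  ultimately show ?thesis
    unfolding std_row_def using zs' False by blast
qed

text \<open>A nonzero constant row is the last row of an invertible matrix, applied to the pair
  \<open>(0, 1)\<close> of the empty list.\<close>

lemma std_row_const:
  assumes "x \<noteq> 0 \<or> y \<noteq> (0::'a::field)"
  shows "std_row (cst x) (cst y)"
proof (cases "x = 0")
  case True
  then show ?thesis
    using assms std_row_combination[of "[]" 0 1 1 y 0 x] by (auto simp: cst_simps)
next
  case False
  then show ?thesis
    using std_row_combination[of "[]" 0 1 0 y 1 x] by (auto simp: cst_simps)
qed

text \<open>Invertible constant matrices compose; the identity in each case is the product formula
  for their determinants.\<close>

lemma std_row_mult_const:
  assumes "std_row x y" "a * d - b * c \<noteq> 0"
  shows "std_row (x * cst a + y * cst c) (x * cst b + y * cst d)"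
proof -
  obtain zs p q k l m where zs: "\<forall>z\<in>set zs. nonconst_aff z" "continuant zs = (p, q)"
    and kl: "k \<noteq> 0" "l \<noteq> 0"
    and "x = cst k * q \<and> y = cst l * p + cst m * q \<or> x = cst k * p \<and> y = cst l * q"
    using assms(1) unfolding std_row_def by blast
  then consider "x = cst k * q" "y = cst l * p + cst m * q" | "x = cst k * p" "y = cst l * q"
    by blast
  then show ?thesis
  proof cases
    case 1
    have "(l * c) * (k * b + m * d) - (l * d) * (k * a + m * c) = - (k * l) * (a * d - b * c)"
      by Groebner_Basis.algebra
    then have "(l * c) * (k * b + m * d) - (l * d) * (k * a + m * c) \<noteq> 0"
      using assms(2) kl by simp
    from std_row_combination[OF zs this] show ?thesis
      unfolding 1 by (simp add: cst_simps algebra_simps)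
  next
    case 2
    have "(k * a) * (l * d) - (k * b) * (l * c) = k * l * (a * d - b * c)"
      by Groebner_Basis.algebra
    then have "(k * a) * (l * d) - (k * b) * (l * c) \<noteq> 0"
      using assms(2) kl by simp
    from std_row_combination[OF zs this] show ?thesis
      unfolding 2 by (simp add: cst_simps algebra_simps)
  qed
qed

text \<open>This is the step in which the continuant grows. In the first cell the shear puts a new
  form in front of the list; in the second it changes the existing first form. If the resulting form
  is constant, the list stays as it was or loses its head, and the row lies in the first
  cell.\<close>

lemma std_row_shear:
  assumes "std_row x y"
  shows "std_row x (y + x * aff \<gamma> \<alpha> \<beta>)"
proof -
  obtain zs p q k l m where zs: "\<forall>z\<in>set zs. nonconst_aff z" "continuant zs = (p, q)"
    and kl: "k \<noteq> 0" "l \<noteq> 0"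
    and "x = cst k * q \<and> y = cst l * p + cst m * q \<or> x = cst k * p \<and> y = cst l * q"
    using assms(1) unfolding std_row_def by blast
  then consider "x = cst k * q" "y = cst l * p + cst m * q" | "x = cst k * p" "y = cst l * q"
    by blast
  then show ?thesis
  proof cases
    case 1
    define z where "z = cst (k / l) * aff \<gamma> \<alpha> \<beta> + cst (m / l)"
    have z: "cst l * z = cst k * aff \<gamma> \<alpha> \<beta> + cst m"
      unfolding z_def using kl by (simp add: distrib_left cst_divide_left cst_divide)
    obtain \<gamma>' \<alpha>' \<beta>' where z': "z = aff \<gamma>' \<alpha>' \<beta>'"
      unfolding z_def aff_mult unfolding aff_cst aff_add by blast
    have y: "y + x * aff \<gamma> \<alpha> \<beta> = cst l * (p + z * q)"
      unfolding 1 using z by Groebner_Basis.algebra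
    show ?thesis
    proof (cases rule: aff_cases[of \<gamma>' \<alpha>' \<beta>'])
      case nonconst: 1
      then have "\<forall>z\<in>set (z # zs). nonconst_aff z" "continuant (z # zs) = (q, p + z * q)"
        using zs z' by auto
      then show ?thesis
        unfolding std_row_def y using 1(1) kl by blast
    next
      case degenerate: 2
      have "y + x * aff \<gamma> \<alpha> \<beta> = cst l * p + cst (l * \<gamma>') * q"
        unfolding y z' degenerate cst_simps by Groebner_Basis.algebra
      then show ?thesis
        unfolding std_row_def using 1(1) kl zs by blast
    qed
  next
    case 2
    define u where "u = cst (k / l) * aff \<gamma> \<alpha> \<beta>"
    have u: "cst l * u = cst k * aff \<gamma> \<alpha> \<beta>"
      unfolding u_def using kl by (simp add: cst_divide_left)
    have y: "y + x * aff \<gamma> \<alpha> \<beta> = cst l * (q + p * u)"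
      unfolding 2 using u by Groebner_Basis.algebra
    show ?thesis
    proof (cases zs)
      case Nil
      then have "p = 0"
        using zs by simp
      then have "y + x * aff \<gamma> \<alpha> \<beta> = cst l * q"
        unfolding y by simp
      then show ?thesis
        unfolding std_row_def using zs kl 2(1) by blast
    next
      case (Cons z1 zs1)
      obtain p' where c1: "continuant zs1 = (p', p)" and q: "q = p' + z1 * p"
        using zs(2) Cons by (cases "continuant zs1") auto
      obtain \<gamma>' \<alpha>' \<beta>' where z': "z1 + u = aff \<gamma>' \<alpha>' \<beta>'"
        using zs(1) Cons by (auto simp: nonconst_aff_def aff_mult aff_add u_def)
      have y': "y + x * aff \<gamma> \<alpha> \<beta> = cst l * (p' + (z1 + u) * p)"
        unfolding y q by Groebner_Basis.algebra
      show ?thesis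
      proof (cases rule: aff_cases[of \<gamma>' \<alpha>' \<beta>'])
        case 1
        then have "\<forall>z\<in>set ((z1 + u) # zs1). nonconst_aff z"
          "continuant ((z1 + u) # zs1) = (p, p' + (z1 + u) * p)"
          using zs z' Cons c1 by auto
        then show ?thesis
          unfolding std_row_def y' using 2(1) kl by blast
      next
        case degenerate: 2
        have "y + x * aff \<gamma> \<alpha> \<beta> = cst l * p' + cst (l * \<gamma>') * p"
          unfolding y' z' degenerate cst_simps by Groebner_Basis.algebra
        moreover have "\<forall>z\<in>set zs1. nonconst_aff z"
          using zs Cons by auto
        ultimately show ?thesis
          unfolding std_row_def using 2(1) kl c1 by blast
      qed
    qed
  qed
qed

text \<open>A constant matrix of determinant 1 with first column \<open>(p, q)\<close> carries the
  row to \<open>e\<close> and a companion \<open>?f\<close>. There the transvection is a shear, and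
  the inverse matrix leads back.\<close>

lemma std_row_transvection:
  assumes "std_row x y" "p \<noteq> 0 \<or> q \<noteq> (0::'a::field)" and e: "e = x * cst p + y * cst q"
  shows "std_row (x - cst q * e * aff 0 \<alpha> \<beta>) (y + cst p * e * aff 0 \<alpha> \<beta>)"
proof -
  obtain g h where gh: "p * h - g * q = 1"
  proof (cases "p = 0")
    case True
    then show ?thesis
      using that[of 0 "- (1 / q)"] that[of "- (1 / q)" 0] assms(2) by simp
  next
    case False
    then show ?thesis
      using that[of "1 / p" 0] by simp
  qed
  let ?f = "x * cst g + y * cst h"
  let ?f' = "?f + e * aff 0 \<alpha> \<beta>"
  have "std_row e ?f'"
    unfolding e using assms(1) gh by (intro std_row_shear std_row_mult_const) auto
  then have "std_row (e * cst h + ?f' * cst (- q)) (e * cst (- g) + ?f' * cst p)"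
    using gh by (intro std_row_mult_const) (auto simp: algebra_simps)
  moreover have gh': "cst p * cst h - cst g * cst q = 1"
    using arg_cong[OF gh, of cst] by (simp add: cst_simps)
  have "e * cst h + ?f' * cst (- q) = x - cst q * e * aff 0 \<alpha> \<beta>"
    unfolding e cst_simps using gh' by Groebner_Basis.algebra
  moreover have "e * cst (- g) + ?f' * cst p = y + cst p * e * aff 0 \<alpha> \<beta>"
    unfolding e cst_simps using gh' by Groebner_Basis.algebra
  ultimately show ?thesis
    by simp
qed

text \<open>Every form has degree one in the outer variable, so the product of all forms is the term
  of highest degree.\<close>

lemma degree_continuant:
  fixes zs :: "'a::field poly poly list"
  assumes "\<forall>z\<in>set zs. nonconst_aff z"
  shows "snd (continuant zs) \<noteq> 0 \<and> degree (snd (continuant zs)) = length zs \<and>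
    (fst (continuant zs) = 0 \<or> degree (fst (continuant zs)) < length zs)"
  using assms
proof (induction zs)
  case (Cons z zs)
  obtain c d where cd: "continuant zs = (c, d)"
    by force
  with Cons have IH: "d \<noteq> 0" "degree d = length zs" "c = 0 \<or> degree c < length zs"
    by auto
  have z: "z \<noteq> 0" "degree z = 1"
    using Cons.prems by (auto simp: nonconst_aff_def aff_def)
  then have "degree (z * d) = Suc (length zs)"
    using IH by (simp add: degree_mult_eq)
  moreover from this have "degree (c + z * d) = degree (z * d)"
    using IH by (cases "c = 0") (simp_all add: degree_add_eq_right)
  ultimately show ?case
    using cd IH by auto
qed simp

text \<open>The left side is t^2 + w t, which is what \<xi>^2 + \<eta> becomes under \<xi> = t,
  \<eta> = w t. The degree forces two forms and hence the shape k (z z' + 1). As the coefficient of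
  t^2 is 1, the linear coefficients of both forms are free of w, so the term w t cannot
  arise.\<close>

lemma quadric_not_scaled_continuant:
  fixes zs :: "'a::field poly poly list"
  assumes "\<forall>z\<in>set zs. nonconst_aff z"
  shows "[:0, [:0, 1:], 1:] \<noteq> cst k * snd (continuant zs)"
proof
  assume eq: "[:0, [:0, 1:], 1:] = cst k * snd (continuant zs)"
  then have "k \<noteq> 0"
    by (auto simp: cst_simps)
  then have "degree (cst k * snd (continuant zs)) = length zs"
    using degree_continuant[OF assms] by (simp add: cst_def)
  then have "length zs = 2"
    unfolding eq[symmetric] by simp
  then obtain z z' where zs: "zs = [z, z']"
    by (metis (no_types) One_nat_def Suc_1 length_0_conv length_Suc_conv)
  obtain \<alpha> \<beta> \<gamma> \<alpha>' \<beta>' \<gamma>' where z: "z = aff \<gamma> \<alpha> \<beta>" "z' = aff \<gamma>' \<alpha>' \<beta>'"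
    using assms unfolding zs nonconst_aff_def by auto
  show False
    using eq \<open>k \<noteq> 0\<close> unfolding zs z by (auto simp: aff_def cst_def one_pCons)
qed

text \<open>Any constant combination of the row is \<open>cst a * p + cst b * q\<close>. If
  \<open>b\<close> is 0, it is a multiple of the continuant of the tail; otherwise the part with
  \<open>p\<close> can be absorbed. Both cases leave a scaled continuant.\<close>

lemma std_row_not_quadric:
  assumes "std_row x (y :: 'a::field poly poly)"
  shows "x * cst u + y * cst v \<noteq> [:0, [:0, 1:], 1:]"
proof
  assume eq: "x * cst u + y * cst v = [:0, [:0, 1:], 1:]"
  obtain zs p q k l m where zs: "\<forall>z\<in>set zs. nonconst_aff z" "continuant zs = (p, q)"
    and "x = cst k * q \<and> y = cst l * p + cst m * q \<or> x = cst k * p \<and> y = cst l * q"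
    using assms(1) unfolding std_row_def by blast
  then have "x * cst u + y * cst v = cst (l * v) * p + cst (k * u + m * v) * q \<or>
    x * cst u + y * cst v = cst (k * u) * p + cst (l * v) * q"
    unfolding cst_simps by (auto simp: algebra_simps)
  then obtain a b where ab: "[:0, [:0, 1:], 1:] = cst a * p + cst b * q"
    unfolding eq by blast
  show False
  proof (cases "b = 0")
    case True
    then have eq: "[:0, [:0, 1:], 1:] = cst a * p"
      using ab by (simp add: cst_simps)
    then have "p \<noteq> 0"
      by auto
    then obtain z zs1 where "zs = z # zs1"
      using zs(2) by (cases zs) auto
    then show False
      using quadric_not_scaled_continuant[of zs1 a] zs eq by auto
  next
    case False
    obtain zs' where zs': "\<forall>z\<in>set zs'. nonconst_aff z" "continuant zs' = (p, q + cst (a / b) * p)"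
      using continuant_absorb[OF zs] by blast
    have "[:0, [:0, 1:], 1:] = cst b * (q + cst (a / b) * p)"
      unfolding ab using False by (simp add: distrib_left cst_divide_left)
    then show False
      using quadric_not_scaled_continuant[OF zs'(1), of b] zs'(2) by simp
  qed
qed

section \<open>Matrices of affine forms with nowhere vanishing determinant\<close>

type_synonym 'a mat22 = "'a \<times> 'a \<times> 'a \<times> 'a"

fun row_mult :: "'a::comm_ring_1 \<times> 'a \<Rightarrow> 'a mat22 \<Rightarrow> 'a \<times> 'a" where
  "row_mult (x, y) (a, b, c, d) = (x * a + y * c, x * b + y * d)"

fun det22 :: "'a::comm_ring_1 mat22 \<Rightarrow> 'a" where
  "det22 (a, b, c, d) = a * d - b * c"

text \<open>On each axis and on the diagonal the polynomial is univariate without roots, hence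
  constant.\<close>

lemma poly2_const_if_no_roots:
  fixes \<delta> \<alpha> \<beta> a b c :: "'a::alg_closed_field"
  assumes "\<And>\<xi> \<eta>. \<delta> + \<alpha> * \<xi> + \<beta> * \<eta> + a * \<xi>^2 + b * \<xi> * \<eta> + c * \<eta>^2 \<noteq> 0"
  shows "\<delta> \<noteq> 0 \<and> \<alpha> = 0 \<and> \<beta> = 0 \<and> a = 0 \<and> b = 0 \<and> c = 0"
proof -
  have *: "q = 0 \<and> r = 0" if "\<And>x. p + q * x + r * x^2 \<noteq> 0" for p q r :: 'a
  proof (rule ccontr)
    assume "\<not> ?thesis"
    then have "degree [:p, q, r:] > 0"
      by auto
    then obtain x where "poly [:p, q, r:] x = 0"
      using alg_closed_imp_poly_has_root by blast
    then show False
      using that[of x] by (simp add: algebra_simps power2_eq_square)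
  qed
  have "\<delta> \<noteq> 0"
    using assms[of 0 0] by simp
  moreover have 1: "\<alpha> = 0 \<and> a = 0"
    using assms[of _ 0] by (intro *[of \<delta>]) simp
  moreover have 2: "\<beta> = 0 \<and> c = 0"
    using assms[of 0] by (intro *[of \<delta>]) simp
  moreover have "0 = (0::'a) \<and> b = 0"
    using assms[of x x for x] 1 2 by (intro *[of \<delta>]) (simp add: power2_eq_square mult.assoc)
  ultimately show ?thesis
    by simp
qed

text \<open>A triple \<open>(x, y, w)\<close> stands for the trace-free matrix with rows
  \<open>(x, y)\<close> and \<open>(w, -x)\<close>. By the hypotheses all linear combinations of the
  two matrices have determinant zero. Then both are multiples of one rank one matrix, the column
  \<open>(p, q)\<close> times the row \<open>(-q, p)\<close>.\<close>

lemma nilpotent_pencil: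
  fixes x y w x' y' w' :: "'a::field"
  assumes "x * x + y * w = 0" "x' * x' + y' * w' = 0" "2 * x * x' + y * w' + y' * w = 0"
  obtains p q \<alpha> \<beta> where "p \<noteq> 0 \<or> q \<noteq> 0"
    "x = - (\<alpha> * p * q)" "y = \<alpha> * p * p" "w = - (\<alpha> * q * q)"
    "x' = - (\<beta> * p * q)" "y' = \<beta> * p * p" "w' = - (\<beta> * q * q)"
proof (cases "w = 0")
  case w: False
  have y: "y = - (x * x) / w"
    using assms(1) w by (simp add: field_simps add_eq_0_iff)
  have x': "x' = w' * x / w \<and> y' = - w' * (x / w) * (x / w)"
  proof (cases "w' = 0")
    case True
    then show ?thesis
      using assms w by simp
  next
    case False
    \<comment> \<open>Times \<open>w * w'\<close>, the mixed condition becomes minus the square of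
      \<open>x * w' - x' * w\<close>, also in characteristic 2.\<close>
    have "w * w' * (2 * x * x' + y * w' + y' * w) = 0"
      using assms(3) by simp
    then have "(x * w' - x' * w)\<^sup>2 = 0"
      using assms(1,2) unfolding power2_eq_square by Groebner_Basis.algebra
    then have "x' = w' * x / w"
      using w by (simp add: field_simps)
    moreover have "y' = - (x' * x') / w'"
      using assms(2) False by (simp add: field_simps add_eq_0_iff)
    ultimately show ?thesis
      using False w by simp
  qed
  show ?thesis
    by (rule that[of "x / w" 1 "- w" "- w'"]) (use w x' y in \<open>simp_all add: field_simps\<close>)
next
  case w: True
  then have x: "x = 0"
    using assms(1) by simp
  show ?thesis
  proof (cases "w' = 0")
    case True
    then show ?thesis
      using assms(2) w x by (intro that[of 1 0 y y']) auto
  next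
    case False
    have "y = 0"
      using assms(3) w x False by simp
    moreover have "y' = - (x' * x') / w'"
      using assms(2) False by (simp add: field_simps add_eq_0_iff)
    ultimately show ?thesis
      using w x False by (intro that[of "x' / w'" 1 0 "- w'"]) (simp_all add: field_simps)
  qed
qed

text \<open>
  A matrix of affine forms whose determinant has no zero is \<open>A (I + \<xi> N\<^sub>1 + \<eta> N\<^sub>2)\<close>, where \<open>A\<close> is
  invertible and, the determinant being constant, \<open>N\<^sub>1\<close> and \<open>N\<^sub>2\<close> span a space of nilpotent
  matrices.
\<close>

lemma std_row_mult_nonvanishing:
  fixes a0 a1 a2 :: "'a::alg_closed_field"
  assumes row: "std_row x y"
    and nz: "\<And>\<xi> \<eta>. det22 (a0 + a1 * \<xi> + a2 * \<eta>, b0 + b1 * \<xi> + b2 * \<eta>,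
      c0 + c1 * \<xi> + c2 * \<eta>, d0 + d1 * \<xi> + d2 * \<eta>) \<noteq> 0"
  shows "std_row (x * aff a0 a1 a2 + y * aff c0 c1 c2) (x * aff b0 b1 b2 + y * aff d0 d1 d2)"
proof -
  define \<delta> where "\<delta> = a0 * d0 - b0 * c0"
  have "\<delta> + (a0 * d1 + a1 * d0 - b0 * c1 - b1 * c0) * \<xi> + (a0 * d2 + a2 * d0 - b0 * c2 - b2 * c0) * \<eta>
    + (a1 * d1 - b1 * c1) * \<xi>^2 + (a1 * d2 + a2 * d1 - b1 * c2 - b2 * c1) * \<xi> * \<eta>
    + (a2 * d2 - b2 * c2) * \<eta>^2 \<noteq> 0" for \<xi> \<eta>
    using nz[of \<xi> \<eta>] unfolding \<delta>_def by (simp add: algebra_simps power2_eq_square)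
  from poly2_const_if_no_roots[OF this]
  have \<delta>: "\<delta> \<noteq> 0" and tr: "a0 * d1 + a1 * d0 - b0 * c1 - b1 * c0 = 0"
    "a0 * d2 + a2 * d0 - b0 * c2 - b2 * c0 = 0"
    and dets: "a1 * d1 - b1 * c1 = 0" "a2 * d2 - b2 * c2 = 0"
    "a1 * d2 + a2 * d1 - b1 * c2 - b2 * c1 = 0"
    by auto
  \<comment> \<open>Entries of the adjugate of the constant part times the coefficient matrix of
    \<open>\<xi>\<close>, and below of \<open>\<eta>\<close>. By \<open>tr\<close> the lower right
    entry is the negative of the upper left one.\<close>
  define x1 y1 w1 where N1: "x1 = d0 * a1 - b0 * c1" "y1 = d0 * b1 - b0 * d1" "w1 = a0 * c1 - c0 * a1"
  define x2 y2 w2 where N2: "x2 = d0 * a2 - b0 * c2" "y2 = d0 * b2 - b0 * d2" "w2 = a0 * c2 - c0 * a2"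
  have tr': "a0 * d1 - c0 * b1 = - x1" "a0 * d2 - c0 * b2 = - x2"
    unfolding N1 N2 using tr by (Groebner_Basis.algebra)+
  have n1: "x1 * x1 + y1 * w1 = 0"
    using tr(1) dets(1) unfolding N1 by Groebner_Basis.algebra
  have n2: "x2 * x2 + y2 * w2 = 0"
    using tr(2) dets(2) unfolding N2 by Groebner_Basis.algebra
  have n3: "2 * x1 * x2 + y1 * w2 + y2 * w1 = 0"
    using tr dets unfolding N1 N2 by Groebner_Basis.algebra
  obtain p q \<alpha> \<beta> where pq: "p \<noteq> 0 \<or> q \<noteq> 0"
    "x1 = - (\<alpha> * p * q)" "y1 = \<alpha> * p * p" "w1 = - (\<alpha> * q * q)"
    "x2 = - (\<beta> * p * q)" "y2 = \<beta> * p * p" "w2 = - (\<beta> * q * q)"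
    using nilpotent_pencil[OF n1 n2 n3] by metis
  \<comment> \<open>Dividing by \<open>\<delta>\<close> replaces the adjugate by the
    inverse.\<close>
  define \<alpha>' \<beta>' where \<alpha>': "\<alpha>' = \<alpha> / \<delta>" and \<beta>': "\<beta>' = \<beta> / \<delta>"
  have B: "a1 = - q * \<alpha>' * (a0 * p + b0 * q)" "b1 = p * \<alpha>' * (a0 * p + b0 * q)"
    "c1 = - q * \<alpha>' * (c0 * p + d0 * q)" "d1 = p * \<alpha>' * (c0 * p + d0 * q)"
  proof -
    have "\<delta> * a1 = a0 * x1 + b0 * w1" "\<delta> * c1 = c0 * x1 + d0 * w1"
      unfolding N1 \<delta>_def by (Groebner_Basis.algebra)+
    moreover have "\<delta> * b1 = a0 * y1 - b0 * x1"
      using tr'(1) unfolding N1 \<delta>_def by Groebner_Basis.algebra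
    moreover have "\<delta> * d1 = c0 * y1 - d0 * x1"
      using tr'(1) unfolding N1 \<delta>_def by Groebner_Basis.algebra
    ultimately show "a1 = - q * \<alpha>' * (a0 * p + b0 * q)" "b1 = p * \<alpha>' * (a0 * p + b0 * q)"
      "c1 = - q * \<alpha>' * (c0 * p + d0 * q)" "d1 = p * \<alpha>' * (c0 * p + d0 * q)"
      using \<delta> unfolding pq \<alpha>' by (simp_all add: field_simps)
  qed
  have C: "a2 = - q * \<beta>' * (a0 * p + b0 * q)" "b2 = p * \<beta>' * (a0 * p + b0 * q)"
    "c2 = - q * \<beta>' * (c0 * p + d0 * q)" "d2 = p * \<beta>' * (c0 * p + d0 * q)"
  proof -
    have "\<delta> * a2 = a0 * x2 + b0 * w2" "\<delta> * c2 = c0 * x2 + d0 * w2"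
      unfolding N2 \<delta>_def by (Groebner_Basis.algebra)+
    moreover have "\<delta> * b2 = a0 * y2 - b0 * x2"
      using tr'(2) unfolding N2 \<delta>_def by Groebner_Basis.algebra
    moreover have "\<delta> * d2 = c0 * y2 - d0 * x2"
      using tr'(2) unfolding N2 \<delta>_def by Groebner_Basis.algebra
    ultimately show "a2 = - q * \<beta>' * (a0 * p + b0 * q)" "b2 = p * \<beta>' * (a0 * p + b0 * q)"
      "c2 = - q * \<beta>' * (c0 * p + d0 * q)" "d2 = p * \<beta>' * (c0 * p + d0 * q)"
      using \<delta> unfolding pq \<beta>' by (simp_all add: field_simps)
  qed
  have expand: "aff \<gamma> \<mu> \<nu> = cst \<gamma> + cst \<mu> * aff 0 1 0 + cst \<nu> * aff 0 0 1" for \<gamma> \<mu> \<nu> :: 'a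
    by (simp add: aff_def cst_def)
  define s1 s2 where s: "s1 = x * cst a0 + y * cst c0" "s2 = x * cst b0 + y * cst d0"
  define e where "e = s1 * cst p + s2 * cst q"
  \<comment> \<open>The constant part acts first; what remains is the identity plus a multiple of
    the rank one nilpotent matrix, that is, a transvection.\<close>
  have "std_row s1 s2"
    unfolding s using row \<delta> by (intro std_row_mult_const) (simp_all add: \<delta>_def)
  then have "std_row (s1 - cst q * e * aff 0 \<alpha>' \<beta>') (s2 + cst p * e * aff 0 \<alpha>' \<beta>')"
    using pq(1) e_def by (rule std_row_transvection)
  moreover have "s1 - cst q * e * aff 0 \<alpha>' \<beta>' = x * aff a0 a1 a2 + y * aff c0 c1 c2"
    unfolding expand[of 0 \<alpha>' \<beta>'] expand[of a0] expand[of c0] B C e_def s cst_simps by Groebner_Basis.algebra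
  moreover have "s2 + cst p * e * aff 0 \<alpha>' \<beta>' = x * aff b0 b1 b2 + y * aff d0 d1 d2"
    unfolding expand[of 0 \<alpha>' \<beta>'] expand[of b0] expand[of d0] B C e_def s cst_simps by Groebner_Basis.algebra
  ultimately show ?thesis
    by simp
qed

section \<open>Products of matrices with weak entries\<close>

text \<open>A constant label has coefficient 0 and an arbitrary index, so that a matrix always names
  at most four variables.\<close>

type_synonym 'a wlabel = "'a \<times> nat \<times> 'a"

fun label_at :: "(nat \<Rightarrow> 'a::comm_ring_1) \<Rightarrow> 'a wlabel \<Rightarrow> 'a" where
  "label_at p (\<alpha>, i, \<beta>) = \<alpha> * p i + \<beta>"

fun mat_at :: "(nat \<Rightarrow> 'a::comm_ring_1) \<Rightarrow> 'a wlabel mat22 \<Rightarrow> 'a mat22" where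
  "mat_at p (a, b, c, d) = (label_at p a, label_at p b, label_at p c, label_at p d)"

fun col_mult :: "'a::comm_ring_1 mat22 \<Rightarrow> 'a \<times> 'a \<Rightarrow> 'a \<times> 'a" where
  "col_mult (a, b, c, d) (x, y) = (a * x + b * y, c * x + d * y)"

fun dot :: "'a::comm_ring_1 \<times> 'a \<Rightarrow> 'a \<times> 'a \<Rightarrow> 'a" where
  "dot (x, y) (u, v) = x * u + y * v"

definition row_at :: "(nat \<Rightarrow> 'a::comm_ring_1) \<Rightarrow> 'a wlabel mat22 list \<Rightarrow> 'a \<times> 'a \<Rightarrow> 'a \<times> 'a" where
  "row_at p Ms r = foldl row_mult r (map (mat_at p) Ms)"

definition col_at :: "(nat \<Rightarrow> 'a::comm_ring_1) \<Rightarrow> 'a wlabel mat22 list \<Rightarrow> 'a \<times> 'a \<Rightarrow> 'a \<times> 'a" where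
  "col_at p Ms c = foldr col_mult (map (mat_at p) Ms) c"

lemma row_at_simps [simp]:
  "row_at p [] r = r"
  "row_at p (M # Ms) r = row_at p Ms (row_mult r (mat_at p M))"
  "row_at p (Ms @ Ns) r = row_at p Ns (row_at p Ms r)"
  by (simp_all add: row_at_def)

lemma col_at_simps [simp]:
  "col_at p [] c = c"
  "col_at p (M # Ms) c = col_mult (mat_at p M) (col_at p Ms c)"
  by (simp_all add: col_at_def)

lemma dot_row_mult: "dot (row_mult r M) c = dot r (col_mult M c)"
  by (cases r; cases M; cases c) (simp add: algebra_simps)

text \<open>Associativity, used to cut the product at any matrix.\<close>

lemma dot_row_at: "dot (row_at p Ms r) c = dot r (col_at p Ms c)"
  by (induction Ms arbitrary: r) (simp_all add: dot_row_mult)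

lemma polyfun_label_at: "polyfun (\<lambda>p. label_at p l)"
  by (cases l) (simp, intro polyfun.intros)

lemma polyfun_row_at:
  "polyfun (\<lambda>p. fst (row_at p Ms r)) \<and> polyfun (\<lambda>p. snd (row_at p Ms r))"
proof (induction Ms rule: rev_induct)
  case Nil
  then show ?case by (auto intro: polyfun.intros)
next
  case (snoc M Ms)
  obtain a b c d where M: "M = (a, b, c, d)" by (cases M)
  have "row_mult r (mat_at p M) =
    (fst r * label_at p a + snd r * label_at p c, fst r * label_at p b + snd r * label_at p d)" for r p
    by (cases r) (simp add: M)
  then show ?case
    using snoc by (auto intro!: polyfun.intros polyfun_label_at)
qed

lemma polyfun_col_at:
  "polyfun (\<lambda>p. fst (col_at p Ms r)) \<and> polyfun (\<lambda>p. snd (col_at p Ms r))"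
proof (induction Ms)
  case Nil
  then show ?case by (auto intro: polyfun.intros)
next
  case (Cons M Ms)
  obtain a b c d where M: "M = (a, b, c, d)" by (cases M)
  have "col_mult (mat_at p M) r =
    (label_at p a * fst r + label_at p b * snd r, label_at p c * fst r + label_at p d * snd r)" for r p
    by (cases r) (simp add: M)
  then show ?case
    using Cons by (auto intro!: polyfun.intros polyfun_label_at)
qed

lemma polyfun_dot:
  assumes "polyfun (\<lambda>p. fst (g p))" "polyfun (\<lambda>p. snd (g p))"
  shows "polyfun (\<lambda>p. dot (g p) c)" "polyfun (\<lambda>p. dot c (g p))"
proof -
  have "dot x c = fst x * fst c + snd x * snd c" "dot c x = fst c * fst x + snd c * snd x" for x
    by (cases x; cases c; simp)+
  then show "polyfun (\<lambda>p. dot (g p) c)" "polyfun (\<lambda>p. dot c (g p))"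
    using assms by (auto intro!: polyfun.intros)
qed

fun mat_vars :: "'a wlabel mat22 \<Rightarrow> nat set" where
  "mat_vars ((_, i, _), (_, j, _), (_, k, _), (_, l, _)) = {i, j, k, l}"

lemma finite_mat_vars: "finite (mat_vars M)"
  by (cases M rule: mat_vars.cases) simp

lemma card_mat_vars: "card (mat_vars M) \<le> 4"
  by (cases M rule: mat_vars.cases) (auto simp: card_insert_if)

lemma mat_at_agree: "p \<in> agree \<tau> (mat_vars M) \<Longrightarrow> mat_at p M = mat_at \<tau> M"
  by (cases M rule: mat_vars.cases) (simp add: agree_def)

lemma singular_mat_rank_one:
  fixes M :: "'a::field mat22"
  assumes "det22 M = 0"
  obtains u1 u2 v1 v2 where "M = (u1 * v1, u1 * v2, u2 * v1, u2 * v2)"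
proof -
  obtain a b c d where M: "M = (a, b, c, d)" by (cases M)
  have det: "a * d = b * c" using assms by (simp add: M)
  consider "a \<noteq> 0" | "b \<noteq> 0" | "a = 0" "b = 0"
    by blast
  then show ?thesis
  proof cases
    case 1
    then show ?thesis
      using det by (intro that[of 1 a b "c / a"]) (simp add: M field_simps)
  next
    case 2
    then show ?thesis
      using det by (intro that[of 1 a b "d / b"]) (simp add: M field_simps)
  next
    case 3
    then show ?thesis
      by (intro that[of 0 c d 1]) (simp add: M)
  qed
qed

text \<open>Indices below 9 are the x-variables, the next nine the y-variables. With nine of each
  kind, one of each stays free when at most eight variables are fixed.\<close>

definition target :: "(nat \<Rightarrow> 'a::comm_ring_1) \<Rightarrow> 'a" where
  "target p = (\<Sum>i<9. p i)^2 + (\<Sum>i<9. p (9 + i))"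

lemma polyfun_target: "polyfun target"
  unfolding target_def[abs_def] by (intro polyfun.add polyfun_power polyfun_sum polyfun.var)

lemma sum_fun_upd_inj:
  fixes p :: "nat \<Rightarrow> 'a::comm_ring_1"
  assumes "finite I" "inj_on g I" "b \<in> I"
  shows "(\<Sum>i\<in>I. (p(g b := p (g b) + t)) (g i)) = (\<Sum>i\<in>I. p (g i)) + t"
proof -
  have "(p(g b := p (g b) + t)) (g i) = p (g i) + (if i = b then t else 0)" if "i \<in> I" for i
    using assms that by (auto simp: inj_on_def)
  then have "(\<Sum>i\<in>I. (p(g b := p (g b) + t)) (g i)) = (\<Sum>i\<in>I. p (g i) + (if i = b then t else 0))"
    by (intro sum.cong) auto
  then show ?thesis
    using assms by (simp add: sum.distrib)
qed

lemma target_shift: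
  assumes "b < 9"
  shows "target (p(9 + b := p (9 + b) + t)) = target p + t"
proof -
  have "(\<Sum>i<9. (p(9 + b := p (9 + b) + t)) i) = (\<Sum>i<9. p i)"
    by (intro sum.cong) auto
  then show ?thesis
    unfolding target_def using assms sum_fun_upd_inj[of "{..<9}" "\<lambda>i. 9 + i" b p t] by simp
qed

lemma free_index:
  assumes "finite S" "card S < n" "inj_on g {..<n}"
  obtains b :: nat where "b < n" "g b \<notin> S"
proof -
  have "\<not> g ` {..<n} \<subseteq> S"
    using assms card_mono[of S "g ` {..<n}"] by (auto simp: card_image)
  then show ?thesis
    using that by auto
qed

text \<open>A rank one matrix splits the product into a scalar \<open>g\<close> from the left and a
  scalar \<open>h\<close> from the right. By \<open>factor_dichotomy\<close> one of them is
  constant, and with it the prefix ending in \<open>M\<close> or the suffix starting with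
  \<open>M\<close>.\<close>

lemma target_singular_mat:
  fixes Ms Ns :: "'a::alg_closed_field wlabel mat22 list"
  assumes prog: "\<And>p. target p = dot (row_at p (Ms @ M # Ns) r) c"
    and sing: "det22 (mat_at \<tau> M) = 0"
  shows "(\<exists>v. \<forall>p \<in> agree \<tau> (mat_vars M). row_at p (Ms @ [M]) r = v) \<or>
    (\<exists>w. \<forall>p \<in> agree \<tau> (mat_vars M). col_at p (M # Ns) c = w)"
proof -
  let ?T = "mat_vars M"
  obtain u1 u2 v1 v2 where M: "mat_at \<tau> M = (u1 * v1, u1 * v2, u2 * v1, u2 * v2)"
    using singular_mat_rank_one[OF sing] .
  define g where "g = (\<lambda>p. dot (row_at p Ms r) (u1, u2))"
  define h where "h = (\<lambda>p. dot (v1, v2) (col_at p Ns c))"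
  have row: "row_at p (Ms @ [M]) r = (g p * v1, g p * v2)" if "p \<in> agree \<tau> ?T" for p
    using mat_at_agree[OF that] by (cases "row_at p Ms r") (simp add: M g_def algebra_simps)
  have col: "col_at p (M # Ns) c = (u1 * h p, u2 * h p)" if "p \<in> agree \<tau> ?T" for p
    using mat_at_agree[OF that] by (cases "col_at p Ns c") (simp add: M h_def algebra_simps)
  have fact: "target p = g p * h p" if "p \<in> agree \<tau> ?T" for p
  proof -
    have "target p = dot (row_at p (Ms @ [M]) r) (col_at p Ns c)"
      by (simp add: prog dot_row_at)
    then show ?thesis
      unfolding row[OF that] by (cases "col_at p Ns c") (simp add: h_def algebra_simps)
  qed
  have "card ?T < 9"
    using card_mat_vars[of M] by linarith
  obtain b where b: "b < 9" "9 + b \<notin> ?T"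
    by (rule free_index[OF finite_mat_vars \<open>card ?T < 9\<close>, of "\<lambda>i. 9 + i"]) auto
  have "polyfun g" "polyfun h"
    unfolding g_def h_def using polyfun_row_at[of Ms r] polyfun_col_at[of Ns c]
    by (simp_all only: polyfun_dot)
  then have "(\<forall>p \<in> agree \<tau> ?T. g p = g \<tau>) \<or> (\<forall>p \<in> agree \<tau> ?T. h p = h \<tau>)"
    using infinite_UNIV_alg_closed polyfun_target target_shift[OF b(1)] fact b(2)
    by (intro factor_dichotomy[of target g h "9 + b" \<tau>]) auto
  then show ?thesis
    using row col by metis
qed

text \<open>Under \<xi> = t, \<eta> = t s every weak label becomes an \<open>aff\<close> form, so
  each matrix preserves the standard form. Nonsingularity is asked for all \<xi> and \<eta>, since
  (t, t s) misses most points with \<xi> = 0.\<close>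

lemma std_row_program:
  fixes x y :: "'a::alg_closed_field poly poly"
  assumes "std_row x y"
    and nonsing: "\<And>M \<xi> \<eta>. M \<in> set Ms \<Longrightarrow> det22 (mat_at (\<lambda>i. p i + q i * \<xi> + r i * \<eta>) M) \<noteq> 0"
  shows "\<exists>x' y'. std_row x' y' \<and> (\<forall>s t.
    row_at (\<lambda>i. p i + q i * t + r i * (t * s)) Ms (eval2 x s t, eval2 y s t) =
    (eval2 x' s t, eval2 y' s t))"
  using assms
proof (induction Ms arbitrary: x y)
  case Nil
  then show ?case by auto
next
  case (Cons M Ms)
  obtain \<alpha>1 i1 \<beta>1 \<alpha>2 i2 \<beta>2 \<alpha>3 i3 \<beta>3 \<alpha>4 i4 \<beta>4 where
    M: "M = ((\<alpha>1, i1, \<beta>1), (\<alpha>2, i2, \<beta>2), (\<alpha>3, i3, \<beta>3), (\<alpha>4, i4, \<beta>4))"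
    by (cases M rule: mat_vars.cases)
  define A where "A = (\<lambda>\<alpha> i \<beta>. aff (\<alpha> * p i + \<beta>) (\<alpha> * q i) (\<alpha> * r i))"
  have A: "eval2 (A \<alpha> i \<beta>) s t = label_at (\<lambda>i. p i + q i * t + r i * (t * s)) (\<alpha>, i, \<beta>)" for \<alpha> i \<beta> s t
    by (simp add: A_def aff_def algebra_simps)
  let ?x = "x * A \<alpha>1 i1 \<beta>1 + y * A \<alpha>3 i3 \<beta>3" and ?y = "x * A \<alpha>2 i2 \<beta>2 + y * A \<alpha>4 i4 \<beta>4"
  have "std_row ?x ?y"
    unfolding A_def
  proof (rule std_row_mult_nonvanishing[OF Cons.prems(1)])
    fix \<xi> \<eta>
    show "det22 (\<alpha>1 * p i1 + \<beta>1 + \<alpha>1 * q i1 * \<xi> + \<alpha>1 * r i1 * \<eta>,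
      \<alpha>2 * p i2 + \<beta>2 + \<alpha>2 * q i2 * \<xi> + \<alpha>2 * r i2 * \<eta>,
      \<alpha>3 * p i3 + \<beta>3 + \<alpha>3 * q i3 * \<xi> + \<alpha>3 * r i3 * \<eta>,
      \<alpha>4 * p i4 + \<beta>4 + \<alpha>4 * q i4 * \<xi> + \<alpha>4 * r i4 * \<eta>) \<noteq> 0"
      using Cons.prems(2)[of M \<xi> \<eta>] by (simp add: M algebra_simps)
  qed
  from Cons.IH[OF this] obtain x' y' where std: "std_row x' y'" and row: "\<forall>s t.
    row_at (\<lambda>i. p i + q i * t + r i * (t * s)) Ms (eval2 ?x s t, eval2 ?y s t) =
    (eval2 x' s t, eval2 y' s t)"
    using Cons.prems(2) by (meson list.set_intros(2))
  have step: "row_mult (eval2 x s t, eval2 y s t) (mat_at (\<lambda>i. p i + q i * t + r i * (t * s)) M)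
    = (eval2 ?x s t, eval2 ?y s t)" for s t
    by (simp only: M mat_at.simps row_mult.simps eval2_simps A)
  show ?case
    by (intro exI[of _ x'] exI[of _ y'] conjI std allI) (simp only: row_at_simps(2) step row)
qed

text \<open>An x-variable and a y-variable remain free. On a suitable plane in these two directions
  \<open>target\<close> is \<xi>^2 + \<eta>, which becomes the quadric that no standard row
  produces.\<close>

lemma target_not_nonsingular_program:
  fixes Ms :: "'a::alg_closed_field wlabel mat22 list"
  assumes S: "finite S" "card S \<le> 8"
    and nonsing: "\<And>M p. M \<in> set Ms \<Longrightarrow> p \<in> agree \<sigma> S \<Longrightarrow> det22 (mat_at p M) \<noteq> 0"
    and prog: "\<And>p. p \<in> agree \<sigma> S \<Longrightarrow> target p = dot (row_at p Ms v) w"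
  shows False
proof -
  have "card S < 9"
    using S(2) by linarith
  note free = free_index[OF S(1) this]
  obtain a where a: "a < 9" "a \<notin> S"
    by (rule free[of "\<lambda>i. i"]) auto
  obtain b where b: "b < 9" "9 + b \<notin> S"
    by (rule free[of "\<lambda>i. 9 + i"]) auto
  \<comment> \<open>The two free coordinates are corrected so that the x-sum and the y-sum both
    vanish at \<open>p\<close>.\<close>
  define p where "p = \<sigma>(a := \<sigma> a - (\<Sum>i<9. \<sigma> i), 9 + b := \<sigma> (9 + b) - (\<Sum>i<9. \<sigma> (9 + i)))"
  define q r :: "nat \<Rightarrow> 'a" where "q = (\<lambda>i. if i = a then 1 else 0)"
    and "r = (\<lambda>i. if i = 9 + b then 1 else 0)"
  define pt where "pt = (\<lambda>\<xi> \<eta> i. p i + q i * \<xi> + r i * \<eta>)"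
  have agr: "pt \<xi> \<eta> \<in> agree \<sigma> S" for \<xi> \<eta>
    using a b by (auto simp: agree_def pt_def p_def q_def r_def)
  have p1: "(\<Sum>i<9. p i) = 0"
  proof -
    have "(\<Sum>i<9. p i) = (\<Sum>i<9. (\<sigma>(a := \<sigma> a + - (\<Sum>i<9. \<sigma> i))) i)"
      by (intro sum.cong) (auto simp: p_def)
    then show ?thesis
      using sum_fun_upd_inj[of "{..<9}" "\<lambda>i. i" a \<sigma> "- (\<Sum>i<9. \<sigma> i)"] a by simp
  qed
  have p2: "(\<Sum>i<9. p (9 + i)) = 0"
  proof -
    have "(\<Sum>i<9. p (9 + i)) =
      (\<Sum>i<9. (\<sigma>(9 + b := \<sigma> (9 + b) + - (\<Sum>i<9. \<sigma> (9 + i)))) (9 + i))"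
      using a by (intro sum.cong) (auto simp: p_def)
    then show ?thesis
      using sum_fun_upd_inj[of "{..<9}" "\<lambda>i. 9 + i" b \<sigma> "- (\<Sum>i<9. \<sigma> (9 + i))"] b by simp
  qed
  have target: "target (pt \<xi> \<eta>) = \<xi>^2 + \<eta>" for \<xi> \<eta>
  proof -
    have "(\<Sum>i<9. pt \<xi> \<eta> i) = (\<Sum>i<9. p i) + (\<Sum>i<9. if i = a then \<xi> else 0)"
      unfolding sum.distrib[symmetric] by (intro sum.cong) (auto simp: pt_def q_def r_def)
    moreover have "(\<Sum>i<9. pt \<xi> \<eta> (9 + i)) = (\<Sum>i<9. p (9 + i)) + (\<Sum>i<9. if i = b then \<eta> else 0)"
      unfolding sum.distrib[symmetric] using a by (intro sum.cong) (auto simp: pt_def q_def r_def)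
    ultimately show ?thesis
      using a b p1 p2 by (simp add: target_def)
  qed
  \<comment> \<open>The standard form has to start from a nonzero row; a zero row would make
    \<open>target\<close> vanish on the plane.\<close>
  have "v \<noteq> (0, 0)"
  proof
    assume v: "v = (0, 0)"
    have "row_at p Ms (0, 0) = (0, 0)" for p
    proof (induction Ms)
      case (Cons M Ms)
      then show ?case by (cases "mat_at p M") simp
    qed simp
    then have "target (pt 0 1) = 0"
      using prog[OF agr, of 0 1] v by (cases w) simp
    then show False
      using target[of 0 1] by simp
  qed
  then have "std_row (cst (fst v)) (cst (snd v))"
    by (intro std_row_const) (auto simp: prod_eq_iff)
  then obtain x y where xy: "std_row x y" and row: "\<And>s t. row_at (pt t (t * s)) Ms v = (eval2 x s t, eval2 y s t)"
    using std_row_program[of "cst (fst v)" "cst (snd v)" Ms p q r] nonsing[OF _ agr]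
    unfolding pt_def by auto
  have "x * cst (fst w) + y * cst (snd w) = [:0, [:0, 1:], 1:]"
  proof (rule eval2_inject[OF infinite_UNIV_alg_closed])
    fix s t
    have "eval2 (x * cst (fst w) + y * cst (snd w)) s t = target (pt t (t * s))"
      using row[of t s] prog[OF agr, of t "t * s"] by (cases w) simp
    then show "eval2 (x * cst (fst w) + y * cst (snd w)) s t = eval2 [:0, [:0, 1:], 1:] s t"
      by (simp add: target power2_eq_square algebra_simps)
  qed
  then show False
    using std_row_not_quadric[OF xy] by blast
qed

theorem target_no_weak_program:
  fixes Ms :: "'a::alg_closed_field wlabel mat22 list"
  assumes prog: "\<And>p. target p = dot (row_at p Ms r) c"
  shows False
proof -
  \<comment> \<open>The bound 4 is the number of variables in one matrix, so a prefix that
    \<open>target_singular_mat\<close> makes constant qualifies.\<close>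
  define const_prefix where "const_prefix = (\<lambda>n \<tau> S v. finite S \<and> card S \<le> 4 \<and>
    (\<forall>p \<in> agree \<tau> S. row_at p (take n Ms) r = v))"
  define good where "good = (\<lambda>n. n \<le> length Ms \<and> (\<exists>\<tau> S v. const_prefix n \<tau> S v))"
  have "const_prefix 0 (\<lambda>_. 0) {} r"
    by (simp add: const_prefix_def)
  then have "good 0"
    unfolding good_def by blast
  moreover have "\<forall>n. good n \<longrightarrow> n \<le> length Ms"
    by (simp add: good_def)
  ultimately obtain n where n: "good n" and max: "\<And>m. good m \<Longrightarrow> m \<le> n"
    using Nat.ex_has_greatest_nat[of good] by blast
  obtain \<tau> S v where S: "finite S" "card S \<le> 4"
    and v: "\<And>p. p \<in> agree \<tau> S \<Longrightarrow> row_at p (take n Ms) r = v" and "n \<le> length Ms"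
    using n unfolding good_def const_prefix_def by blast
  define nonsing where "nonsing = (\<lambda>M. \<forall>p \<in> agree \<tau> S. det22 (mat_at p M) \<noteq> 0)"
  \<comment> \<open>On the subspace \<open>Cs\<close> is nonsingular everywhere, while
    \<open>Ds\<close> is empty or starts with a matrix that some point of the subspace makes
    singular.\<close>
  define Cs Ds where "Cs = takeWhile nonsing (drop n Ms)" and "Ds = dropWhile nonsing (drop n Ms)"
  have Ms: "Ms = take n Ms @ Cs @ Ds"
    by (simp add: Cs_def Ds_def)
  have Cs: "nonsing M" if "M \<in> set Cs" for M
    using that unfolding Cs_def by (blast dest: set_takeWhileD)
  have "\<exists>\<sigma> \<in> agree \<tau> S. \<exists>T w. finite T \<and> card T \<le> 4 \<and> (\<forall>p \<in> agree \<sigma> T. col_at p Ds c = w)"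
  proof (cases Ds)
    case Nil
    then have "finite {} \<and> card ({}::nat set) \<le> 4 \<and> (\<forall>p \<in> agree \<tau> {}. col_at p Ds c = c)"
      by simp
    moreover have "\<tau> \<in> agree \<tau> S"
      by (simp add: agree_def)
    ultimately show ?thesis
      by blast
  next
    case (Cons M Ds')
    then have "\<not> nonsing M"
      unfolding Ds_def by (metis hd_dropWhile list.distinct(1) list.sel(1))
    then obtain \<sigma> where \<sigma>: "\<sigma> \<in> agree \<tau> S" "det22 (mat_at \<sigma> M) = 0"
      unfolding nonsing_def by blast
    let ?Pre = "take n Ms @ Cs" and ?m = "n + length Cs + 1"
    have Ms': "Ms = ?Pre @ M # Ds'"
      using Ms Cons by simp
    then have Ms'': "Ms = (?Pre @ [M]) @ Ds'"
      by simp
    have len: "length (?Pre @ [M]) = ?m"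
      using \<open>n \<le> length Ms\<close> by simp
    have "?m \<le> length Ms"
      using arg_cong[OF Ms'', of length] len by simp
    moreover have take: "take ?m Ms = ?Pre @ [M]"
      using Ms'' len by (metis append_eq_conv_conj)
    \<comment> \<open>The prefix through \<open>M\<close> is longer than the maximal one, so of the
      two alternatives only the constant suffix remains.\<close>
    moreover have "\<not> good ?m"
      using max[of ?m] by auto
    ultimately have "\<not> const_prefix ?m \<sigma> (mat_vars M) v" for v
      unfolding good_def by blast
    then have "\<nexists>v. \<forall>p \<in> agree \<sigma> (mat_vars M). row_at p (?Pre @ [M]) r = v"
      unfolding const_prefix_def take by (simp add: finite_mat_vars card_mat_vars)
    moreover have "target p = dot (row_at p (?Pre @ M # Ds') r) c" for p
      by (subst Ms'[symmetric]) (rule prog)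
    ultimately have "\<exists>w. \<forall>p \<in> agree \<sigma> (mat_vars M). col_at p (M # Ds') c = w"
      using target_singular_mat[of ?Pre M Ds' r c \<sigma>] \<sigma>(2) by blast
    then show ?thesis
      unfolding Cons using \<sigma>(1) finite_mat_vars card_mat_vars by blast
  qed
  then obtain \<sigma> T w where \<sigma>: "\<sigma> \<in> agree \<tau> S" and T: "finite T" "card T \<le> 4"
    and w: "\<And>p. p \<in> agree \<sigma> T \<Longrightarrow> col_at p Ds c = w"
    by blast
  \<comment> \<open>Since \<open>\<sigma>\<close> itself agrees with \<open>\<tau>\<close> on
    \<open>S\<close>, both choices of fixed variables can be made at once.\<close>
  have agr: "p \<in> agree \<tau> S" "p \<in> agree \<sigma> T" if "p \<in> agree \<sigma> (S \<union> T)" for p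
    using that \<sigma> by (auto simp: agree_def)
  show False
  proof (rule target_not_nonsingular_program[of "S \<union> T" Cs \<sigma> v w])
    show "finite (S \<union> T)" "card (S \<union> T) \<le> 8"
      using S T card_Un_le[of S T] by simp_all
    show "det22 (mat_at p M) \<noteq> 0" if "M \<in> set Cs" "p \<in> agree \<sigma> (S \<union> T)" for M p
      using Cs[OF that(1)] agr[OF that(2)] unfolding nonsing_def by blast
    show "target p = dot (row_at p Cs v) w" if "p \<in> agree \<sigma> (S \<union> T)" for p
    proof -
      have "target p = dot (row_at p (take n Ms @ Cs @ Ds) r) c"
        by (subst Ms[symmetric]) (rule prog)
      then show ?thesis
        by (simp add: v[OF agr(1)[OF that]] dot_row_at[of p Ds] w[OF agr(2)[OF that]])
    qed
  qed
qed

section \<open>Branching programs as matrix products\<close>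

text \<open>The sink is kept and the start varies, so that the value can be computed backwards,
  layer by layer.\<close>

definition path_sum :: "'a::field abp \<Rightarrow> nat \<Rightarrow> 'a mpoly" where
  "path_sum A v = (\<Sum>p | pre_digraph.apath (with_proj (graph A)) v p (sink A).
     prod_list (map (label A) p))"

locale layered_abp =
  fixes A :: "'a::field abp" and L :: "'a mpoly set"
  assumes is_abp: "is_abp L A"
begin

sublocale pair_fin_digraph "graph A"
  using is_abp by (simp add: is_abp_def)

lemma layer_arc: "(u, v) \<in> parcs (graph A) \<Longrightarrow> layer A v = layer A u + 1"
  using is_abp by (auto simp: is_abp_def)

lemma label_arc: "e \<in> parcs (graph A) \<Longrightarrow> label A e \<in> L"
  using is_abp by (auto simp: is_abp_def)

lemma sink_in_verts: "sink A \<in> pverts (graph A)" and source_in_verts: "source A \<in> pverts (graph A)"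
  using is_abp by (auto simp: is_abp_def)

lemma layer_awalk_verts: "awalk u p v \<Longrightarrow> w \<in> set (pawalk_verts u p) \<Longrightarrow> layer A u \<le> layer A w"
proof (induction p arbitrary: u)
  case Nil
  then show ?case by simp
next
  case (Cons e p)
  then show ?case
    using layer_arc[of "fst e" "snd e"] by (fastforce simp: awalk_Cons_iff)
qed

text \<open>Layers increase along arcs, so a walk never returns and the distinctness required of
  paths is automatic.\<close>

lemma apath_Cons: "apath u (e # p) v \<longleftrightarrow> e \<in> parcs (graph A) \<and> fst e = u \<and> apath (snd e) p v"
proof -
  have "u \<notin> set (pawalk_verts (snd e) p)" if "e \<in> parcs (graph A)" "fst e = u" "apath (snd e) p v"
    using layer_awalk_verts[of "snd e" p v u] layer_arc[of "fst e" "snd e"] that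
    by (auto simp: apath_def)
  then show ?thesis
    by (auto simp: apath_Cons_iff)
qed

lemma layer_apath: "apath u p v \<Longrightarrow> layer A v = layer A u + length p"
proof (induction p arbitrary: u)
  case (Cons e p)
  then show ?case
    using layer_arc[of "fst e" "snd e"] by (auto simp: apath_Cons)
qed (simp add: apath_Nil_iff)

text \<open>Paths are sorted by their first arc; the summand 1 is the empty path at the
  sink.\<close>

lemma path_sum_rec:
  "path_sum A v = (if v = sink A then 1 else 0) +
     (\<Sum>u | (v, u) \<in> parcs (graph A). label A (v, u) * path_sum A u)"
proof -
  define N where "N = {u. (v, u) \<in> parcs (graph A)}"
  define P where "P = (\<lambda>u. {p. apath u p (sink A)})"
  define w where "w = (\<lambda>p. prod_list (map (label A) p))"
  have "N \<subseteq> pverts (graph A)"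
    using in_arcsD2 by (auto simp: N_def)
  then have fin: "finite N" "finite (P u)" for u
    using finite_subset[OF _ pair_finite_verts] apaths_finite[of u "sink A"] by (simp_all add: P_def)
  have "P v = (if v = sink A then {[]} else {}) \<union> (\<Union>u\<in>N. (\<lambda>p. (v, u) # p) ` P u)" (is "_ = ?E \<union> ?U")
  proof (intro equalityI subsetI)
    fix p assume "p \<in> P v"
    then show "p \<in> ?E \<union> ?U"
      by (cases p) (auto simp: P_def N_def apath_Nil_iff apath_Cons)
  next
    fix p assume "p \<in> ?E \<union> ?U"
    then show "p \<in> P v"
      using sink_in_verts by (auto simp: P_def N_def apath_Nil_iff apath_Cons split: if_splits)
  qed
  moreover have "?E \<inter> ?U = {}"
    by auto
  ultimately have "sum w (P v) = sum w ?E + sum w ?U"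
    using fin by (simp add: sum.union_disjoint)
  also have "sum w ?E = (if v = sink A then 1 else 0)"
    by (simp add: w_def)
  also have "sum w ?U = (\<Sum>u\<in>N. \<Sum>p\<in>(\<lambda>p. (v, u) # p) ` P u. w p)"
    using fin by (intro sum.UNION_disjoint) auto
  also have "\<dots> = (\<Sum>u\<in>N. label A (v, u) * sum w (P u))"
    by (simp add: sum.reindex inj_on_def w_def sum_distrib_left)
  finally show ?thesis
    by (simp add: path_sum_def P_def w_def N_def)
qed

text \<open>Makes the padding of small layers harmless.\<close>

lemma path_sum_outside:
  assumes "v \<notin> pverts (graph A)"
  shows "path_sum A v = 0"
proof -
  have "v \<noteq> sink A" "{u. (v, u) \<in> parcs (graph A)} = {}"
    using assms sink_in_verts in_arcsD1 by auto
  then show ?thesis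
    by (subst path_sum_rec) simp
qed

lemma path_sum_late:
  assumes "layer A v \<ge> layer A (sink A)" "v \<noteq> sink A"
  shows "path_sum A v = 0"
proof -
  have "\<not> apath v p (sink A)" for p
    using layer_apath[of v p "sink A"] assms by (cases p) (auto simp: apath_Nil_iff)
  then show ?thesis
    by (simp add: path_sum_def)
qed

lemma path_sum_sink: "path_sum A (sink A) = 1"
proof -
  have "path_sum A u = 0" if "(sink A, u) \<in> parcs (graph A)" for u
    using layer_arc[OF that] by (intro path_sum_late) auto
  then show ?thesis
    by (subst path_sum_rec) simp
qed

definition layer_verts :: "nat \<Rightarrow> nat set" where
  "layer_verts i = {v \<in> pverts (graph A). layer A v = i}"

lemma card_layer_verts:
  assumes "abp_width A \<le> k"
  shows "card (layer_verts i) \<le> k"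
proof (cases "layer_verts i = {}")
  case False
  then have "card (layer_verts i) \<le> abp_width A"
    unfolding abp_width_def layer_verts_def using pair_finite_verts by (intro Max_ge) auto
  then show ?thesis
    using assms by simp
qed simp

text \<open>Layers with fewer than two vertices are padded with numbers that are not vertices.\<close>

lemma layer_pair:
  assumes "abp_width A \<le> 2"
  obtains x y where "x \<noteq> y" "layer_verts i \<subseteq> {x, y}" "{x, y} \<inter> pverts (graph A) \<subseteq> layer_verts i"
proof -
  have fin: "finite (pverts (graph A))"
    by (rule pair_finite_verts)
  have sub: "layer_verts i \<subseteq> pverts (graph A)"
    by (auto simp: layer_verts_def)
  obtain a where a: "a \<notin> pverts (graph A)"
    using fin ex_new_if_finite infinite_UNIV_nat by blast
  obtain b where b: "b \<notin> insert a (pverts (graph A))"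
    using fin ex_new_if_finite[of "insert a (pverts (graph A))"] infinite_UNIV_nat by blast
  have "card (layer_verts i) \<in> {0, 1, 2}"
    using card_layer_verts[OF assms, of i] by auto
  then consider "layer_verts i = {}" | x where "layer_verts i = {x}"
    | x y where "layer_verts i = {x, y}" "x \<noteq> y"
    using finite_subset[OF sub fin] by (auto simp: card_1_singleton_iff card_2_iff)
  then show ?thesis
  proof cases
    case 1
    then show ?thesis using a b by (intro that[of a b]) auto
  next
    case (2 x)
    then show ?thesis using a sub by (intro that[of x a]) auto
  next
    case (3 x y)
    then show ?thesis by (intro that[of x y]) auto
  qed
qed

end

text \<open>Labels are tested through their evaluations, which lets the matrices live over the
  larger ring \<open>'b\<close>.\<close>

locale weak_abp = layered_abp A L + semiring_hom \<phi>
  for A :: "'a::field abp" and L and \<phi> :: "'a \<Rightarrow> 'b::comm_ring_1" +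
  assumes width: "abp_width A \<le> 2"
    and weak: "e \<in> L \<Longrightarrow> \<exists>l. \<forall>p. mpoly_eval \<phi> p e = label_at p l"
begin

text \<open>Missing arcs receive the zero label, so that two pairs of vertices in consecutive layers
  give a full 2 x 2 matrix.\<close>

definition arc_label :: "nat \<Rightarrow> nat \<Rightarrow> 'b wlabel" where
  "arc_label u v = (if (u, v) \<in> parcs (graph A)
     then SOME l. \<forall>p. mpoly_eval \<phi> p (label A (u, v)) = label_at p l else (0, 0, 0))"

lemma label_at_arc_label:
  "label_at p (arc_label u v) =
     (if (u, v) \<in> parcs (graph A) then mpoly_eval \<phi> p (label A (u, v)) else 0)"
proof (cases "(u, v) \<in> parcs (graph A)")
  case True
  then have "\<exists>l. \<forall>p. mpoly_eval \<phi> p (label A (u, v)) = label_at p l"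
    by (rule weak[OF label_arc])
  from someI_ex[OF this] have "\<forall>p. mpoly_eval \<phi> p (label A (u, v)) = label_at p (arc_label u v)"
    unfolding arc_label_def if_P[OF True] .
  then show ?thesis
    using True by simp
qed (simp add: arc_label_def)

text \<open>Induction on the distance \<open>k\<close> from the layer of the sink: each step
  multiplies by the matrix of labels between two consecutive layers.\<close>

lemma column_program:
  assumes "n + k = layer A (sink A)"
  shows "\<exists>x y Ms c. layer_verts n \<subseteq> {x, y} \<and> x \<noteq> y \<and> (\<forall>p.
    (mpoly_eval \<phi> p (path_sum A x), mpoly_eval \<phi> p (path_sum A y)) = col_at p Ms c)"
  using assms
proof (induction k arbitrary: n)
  case 0
  obtain x y where xy: "x \<noteq> y" "layer_verts n \<subseteq> {x, y}"
    "{x, y} \<inter> pverts (graph A) \<subseteq> layer_verts n"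
    using layer_pair[OF width] .
  have *: "mpoly_eval \<phi> p (path_sum A v) = (if v = sink A then 1 else 0)" if "v \<in> {x, y}" for v p
  proof -
    consider "v = sink A" | "v \<notin> pverts (graph A)" | "v \<in> pverts (graph A)" "v \<noteq> sink A"
      by blast
    then show ?thesis
    proof cases
      case 1
      then show ?thesis
        by (simp add: path_sum_sink)
    next
      case 2
      then have "v \<noteq> sink A"
        using sink_in_verts by blast
      with 2 show ?thesis
        by (simp add: path_sum_outside)
    next
      case 3
      then have "layer A v = layer A (sink A)"
        using xy(3) that 0 by (auto simp: layer_verts_def)
      then show ?thesis
        using 3 path_sum_late[of v] by simp
    qed
  qed
  show ?case
    by (intro exI[of _ x] exI[of _ y] exI[of _ "[]"]
        exI[of _ "(if x = sink A then 1 else 0, if y = sink A then 1 else 0)"] conjI xy allI)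
      (simp add: *)
next
  case (Suc k)
  have "Suc n + k = layer A (sink A)"
    using Suc.prems by simp
  from Suc.IH[OF this] obtain x' y' Ms c where IH: "layer_verts (Suc n) \<subseteq> {x', y'}" "x' \<noteq> y'"
    "\<forall>p. (mpoly_eval \<phi> p (path_sum A x'), mpoly_eval \<phi> p (path_sum A y')) = col_at p Ms c"
    by (elim exE conjE) (rule that)
  obtain x y where xy: "x \<noteq> y" "layer_verts n \<subseteq> {x, y}"
    "{x, y} \<inter> pverts (graph A) \<subseteq> layer_verts n"
    using layer_pair[OF width] .
  have *: "mpoly_eval \<phi> p (path_sum A v) =
      label_at p (arc_label v x') * mpoly_eval \<phi> p (path_sum A x') +
      label_at p (arc_label v y') * mpoly_eval \<phi> p (path_sum A y')" if v: "v \<in> {x, y}" for v p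
  proof -
    have "v \<noteq> sink A"
      using xy(3) v sink_in_verts Suc.prems by (auto simp: layer_verts_def)
    moreover have sub: "{u. (v, u) \<in> parcs (graph A)} \<subseteq> {x', y'}"
    proof
      fix u assume "u \<in> {u. (v, u) \<in> parcs (graph A)}"
      then have "v \<in> layer_verts n" "u \<in> pverts (graph A)" "layer A u = layer A v + 1"
        using v xy(3) in_arcsD1 in_arcsD2 layer_arc by auto
      then show "u \<in> {x', y'}"
        using IH(1) by (auto simp: layer_verts_def)
    qed
    ultimately have "mpoly_eval \<phi> p (path_sum A v) = (\<Sum>u | (v, u) \<in> parcs (graph A).
        label_at p (arc_label v u) * mpoly_eval \<phi> p (path_sum A u))"
      by (subst path_sum_rec) (simp add: mpoly_eval_sum mpoly_eval_mult mpoly_eval_add label_at_arc_label)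
    also have "\<dots> = (\<Sum>u\<in>{x', y'}. label_at p (arc_label v u) * mpoly_eval \<phi> p (path_sum A u))"
      using sub by (intro sum.mono_neutral_left) (auto simp: label_at_arc_label)
    finally show ?thesis
      using IH(2) by simp
  qed
  show ?case
    by (intro exI[of _ x] exI[of _ y] exI[of _ c] exI[of _
        "(arc_label x x', arc_label x y', arc_label y x', arc_label y y') # Ms"] conjI xy allI)
      (simp add: * flip: IH(3)[rule_format])
qed

text \<open>The column of the source layer contains the value, and a unit row selects it.\<close>

lemma abp_value_program:
  "\<exists>Ms r c. \<forall>p. mpoly_eval \<phi> p (abp_value A) = dot (row_at p Ms r) c"
proof (cases "layer A (source A) \<le> layer A (sink A)")
  case True
  then obtain k where "layer A (source A) + k = layer A (sink A)"
    using le_Suc_ex by metis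
  from column_program[OF this] obtain x y Ms c where src: "layer_verts (layer A (source A)) \<subseteq> {x, y}"
    and col: "\<And>p. col_at p Ms c = (mpoly_eval \<phi> p (path_sum A x), mpoly_eval \<phi> p (path_sum A y))"
    by metis
  have val: "abp_value A = path_sum A (source A)"
    by (simp add: abp_value_def path_sum_def)
  have "source A = x \<or> source A = y"
    using src source_in_verts by (auto simp: layer_verts_def)
  then show ?thesis
  proof
    assume "source A = x"
    then show ?thesis
      by (intro exI[of _ Ms] exI[of _ "(1, 0)"] exI[of _ c]) (simp add: val dot_row_at col)
  next
    assume "source A = y"
    then show ?thesis
      by (intro exI[of _ Ms] exI[of _ "(0, 1)"] exI[of _ c]) (simp add: val dot_row_at col)
  qed
next
  \<comment> \<open>With the source in a later layer than the sink there is no path.\<close>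
  case False
  then have "path_sum A (source A) = 0"
    by (intro path_sum_late) auto
  then have "abp_value A = 0"
    by (simp add: abp_value_def path_sum_def)
  then show ?thesis
    by (intro exI[of _ "[]"] exI[of _ "(0, 0)"] exI[of _ "(0, 0)"]) simp
qed

end

section \<open>The separating polynomial\<close>

lemma vars_add: "vars (f + g) \<subseteq> vars f \<union> vars g"
  using Poly_Mapping.keys_add[of f g] by (auto simp: vars_def)

lemma vars_sum: "vars (\<Sum>i\<in>I. f i) \<subseteq> (\<Union>i\<in>I. vars (f i))"
proof (induction I rule: infinite_finite_induct)
  case (insert i I)
  then show ?case using vars_add[of "f i" "sum f I"] by auto
qed (auto simp: vars_def)

lemma vars_mult: "vars (f * g) \<subseteq> vars f \<union> vars g"
proof
  fix i assume "i \<in> vars (f * g)"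
  then obtain m where m: "m \<in> Poly_Mapping.keys (f * g)" "i \<in> Poly_Mapping.keys m"
    by (auto simp: vars_def)
  then obtain a b where ab: "m = a + b" "a \<in> Poly_Mapping.keys f" "b \<in> Poly_Mapping.keys g"
    using keys_mult[of f g] by auto
  then have "i \<in> Poly_Mapping.keys a \<union> Poly_Mapping.keys b"
    using m(2) Poly_Mapping.keys_add[of a b] by auto
  then show "i \<in> vars f \<union> vars g"
    using ab by (auto simp: vars_def)
qed

lemma vars_Var: "vars (Var i) \<subseteq> {i}"
  by (auto simp: vars_def Var_def split: if_splits)

lemma Const_0 [simp]: "Const 0 = 0" and Const_1 [simp]: "Const (1::'a::comm_semiring_1) = 1"
  by (simp_all add: Const_def)

definition x_sum :: "'a::comm_ring_1 mpoly" where "x_sum = (\<Sum>i<9. Var i)"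
definition y_sum :: "'a::comm_ring_1 mpoly" where "y_sum = (\<Sum>i<9. Var (9 + i))"
definition target_mpoly :: "'a::comm_ring_1 mpoly" where "target_mpoly = x_sum ^ 2 + y_sum"

lemma vars_target_mpoly: "vars (target_mpoly :: 'a::comm_ring_1 mpoly) \<subseteq> {..<18}"
proof -
  have 1: "vars (x_sum :: 'a mpoly) \<subseteq> {..<18}"
    using vars_sum[of "Var :: nat \<Rightarrow> 'a mpoly" "{..<9}"] vars_Var unfolding x_sum_def by fastforce
  have 2: "vars (y_sum :: 'a mpoly) \<subseteq> {..<18}"
    using vars_sum[of "\<lambda>i. Var (9 + i) :: 'a mpoly" "{..<9}"] vars_Var unfolding y_sum_def by fastforce
  show ?thesis
    using 1 2 vars_mult[of x_sum "x_sum :: 'a mpoly"] vars_add[of "x_sum * x_sum" "y_sum :: 'a mpoly"]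
    unfolding target_mpoly_def power2_eq_square by blast
qed

section \<open>Inclusion of the classes\<close>

lemma weak_labels_subset: "weak_labels m \<subseteq> general_labels m"
proof
  fix e :: "'a mpoly" assume "e \<in> weak_labels m"
  then consider \<alpha> i \<beta> where "i < m" "e = Const \<alpha> * Var i + Const \<beta>" | \<beta> where "e = Const \<beta>"
    by (auto simp: weak_labels_def)
  then show "e \<in> general_labels m"
  proof cases
    case (1 \<alpha> i \<beta>)
    have "(\<Sum>j<m. Const (if j = i then \<alpha> else 0) * Var j) = (\<Sum>j<m. if j = i then Const \<alpha> * Var j else 0 :: 'a mpoly)"
      by (intro sum.cong) auto
    also have "\<dots> = Const \<alpha> * Var i"
      using 1 by simp
    finally show ?thesis
      unfolding general_labels_def 1(2)
      by (intro CollectI exI[of _ "\<lambda>j. if j = i then \<alpha> else 0"] exI[of _ \<beta>]) simp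
  next
    case (2 \<beta>)
    then show ?thesis
      unfolding general_labels_def by (intro CollectI exI[of _ "\<lambda>_. 0"] exI[of _ \<beta>]) simp
  qed
qed

lemma is_abp_mono: "L \<subseteq> L' \<Longrightarrow> is_abp L A \<Longrightarrow> is_abp L' A"
  by (auto simp: is_abp_def)

lemma abp_class_mono:
  assumes "\<And>m. L m \<subseteq> L' m"
  shows "abp_class L k \<subseteq> abp_class L' k"
  unfolding abp_class_def using is_abp_mono[OF assms] by (intro Collect_mono) meson

section \<open>A general program of width two for the separating polynomial\<close>

lemma lin_general_label:
  "(x_sum :: 'a::field mpoly) \<in> general_labels 18" "(y_sum :: 'a mpoly) \<in> general_labels 18"
proof -
  have "(\<Sum>i<18. Const (if i < 9 then 1 else 0) * Var i :: 'a mpoly) = (\<Sum>i<9. Var i)"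
    by (rule sum.mono_neutral_cong_right) auto
  then show "(x_sum :: 'a mpoly) \<in> general_labels 18"
    unfolding general_labels_def x_sum_def
    by (intro CollectI exI[of _ "\<lambda>i. if i < 9 then 1 else 0"] exI[of _ 0]) simp
  have "(\<Sum>i<18. Const (if 9 \<le> i then 1 else 0) * Var i :: 'a mpoly) = (\<Sum>i\<in>{9..<18}. Var i)"
    by (rule sum.mono_neutral_cong_right) auto
  also have "\<dots> = (\<Sum>i<9. Var (9 + i))"
    by (rule sum.reindex_bij_witness[of _ "\<lambda>i. 9 + i" "\<lambda>i. i - 9"]) auto
  finally show "(y_sum :: 'a mpoly) \<in> general_labels 18"
    unfolding general_labels_def y_sum_def
    by (intro CollectI exI[of _ "\<lambda>i. if 9 \<le> i then 1 else 0"] exI[of _ 0]) simp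
qed

lemma const_general_label: "Const c \<in> general_labels m"
  using weak_labels_subset by (force simp: weak_labels_def)

text \<open>A diamond with two paths: through 1 the product is \<open>x_sum * x_sum\<close>, through
  2 it is \<open>y_sum * 1\<close>.\<close>

definition target_abp :: "'a::field abp" where
  "target_abp = \<lparr>graph = \<lparr>pverts = {0, 1, 2, 3}, parcs = {(0, 1), (0, 2), (1, 3), (2, 3)}\<rparr>,
     layer = (\<lambda>v. if v = 0 then 0 else if v = 3 then 2 else 1),
     label = (\<lambda>e. if e = (0, 2) then y_sum else if e = (2, 3) then 1 else x_sum),
     source = 0, sink = 3\<rparr>"

lemma is_abp_target_abp: "is_abp (general_labels 18) target_abp"
proof -
  have "pair_fin_digraph (graph target_abp)"
    by unfold_locales (auto simp: target_abp_def)
  moreover have "(1 :: 'a mpoly) \<in> general_labels 18"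
    using const_general_label[of 1] by simp
  ultimately show ?thesis
    by (auto simp: is_abp_def target_abp_def lin_general_label)
qed

lemma abp_width_target_abp: "abp_width target_abp \<le> 2"
proof -
  have "{v \<in> {0, 1, 2, 3 :: nat}. (if v = 0 then 0 else if v = 3 then 2 else 1) = i} \<subseteq>
    (if i = 1 then {1, 2} else if i = 0 then {0} else {3})" (is "?V i \<subseteq> ?W i") for i :: nat
    by auto
  then have "card (?V i) \<le> card (?W i)" for i
    by (intro card_mono) auto
  also have "card (?W i) \<le> 2" for i
    by auto
  finally show ?thesis
    unfolding abp_width_def target_abp_def by (intro Max.boundedI) auto
qed

lemma abp_value_target_abp: "abp_value (target_abp :: 'a::field abp) = target_mpoly"
proof -
  let ?A = "target_abp :: 'a abp"
  interpret layered_abp ?A "general_labels 18"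
    by unfold_locales (rule is_abp_target_abp)
  have arcs: "{u. (0, u) \<in> parcs (graph ?A)} = {1, 2}"
    "{u. (1, u) \<in> parcs (graph ?A)} = {3}"
    "{u. (2, u) \<in> parcs (graph ?A)} = {3}" and sink: "sink ?A = 3"
    by (auto simp: target_abp_def)
  have labels: "label ?A (0, 1) = x_sum" "label ?A (0, 2) = y_sum"
    "label ?A (1, 3) = x_sum" "label ?A (2, 3) = 1"
    by (simp_all add: target_abp_def)
  have "path_sum ?A 3 = 1"
    using path_sum_sink by (simp add: sink)
  then have "path_sum ?A 1 = x_sum" "path_sum ?A 2 = 1"
    using path_sum_rec[of 1] path_sum_rec[of 2]
    by (simp_all add: arcs sink labels del: One_nat_def)
  then have "path_sum ?A 0 = x_sum * x_sum + y_sum"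
    using path_sum_rec[of 0] by (simp add: arcs sink labels del: One_nat_def)
  moreover have "source ?A = 0"
    by (simp add: target_abp_def)
  ultimately show ?thesis
    by (simp add: abp_value_def path_sum_def target_mpoly_def power2_eq_square)
qed

lemma target_in_VP2_gen: "(\<lambda>_. target_mpoly) \<in> VP2_gen"
proof -
  have bounded: "poly_bounded (\<lambda>_. c)" for c
    unfolding poly_bounded_def by (intro exI[of _ "[:c:]"]) simp
  have "abp_size target_abp \<le> 4"
    by (simp add: abp_size_def target_abp_def)
  then have "\<exists>A. is_abp (general_labels 18) A \<and> abp_width A \<le> 2 \<and> abp_size A \<le> 4 \<and> abp_value A = target_mpoly"
    using is_abp_target_abp abp_width_target_abp abp_value_target_abp by blast
  then show ?thesis
    unfolding VP2_gen_def abp_class_def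
    using vars_target_mpoly bounded[of 18] bounded[of 4] by blast
qed

section \<open>Passage to the algebraic closure\<close>

lemma semiring_hom_to_ac: "semiring_hom to_ac"
  by unfold_locales simp_all

lemma mpoly_eval_target_mpoly:
  "mpoly_eval to_ac p (target_mpoly :: 'a::field mpoly) = target p"
proof -
  interpret semiring_hom "to_ac :: 'a \<Rightarrow> 'a alg_closure"
    by (rule semiring_hom_to_ac)
  show ?thesis
    by (simp add: target_mpoly_def x_sum_def y_sum_def target_def power2_eq_square
        mpoly_eval_add mpoly_eval_mult mpoly_eval_sum)
qed

lemma weak_label_eval:
  fixes e :: "'a::field mpoly"
  assumes "e \<in> weak_labels m"
  shows "\<exists>l. \<forall>p. mpoly_eval to_ac p e = label_at p l"
proof -
  interpret semiring_hom "to_ac :: 'a \<Rightarrow> 'a alg_closure"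
    by (rule semiring_hom_to_ac)
  consider \<alpha> i \<beta> where "e = Const \<alpha> * Var i + Const \<beta>" | \<beta> where "e = Const \<beta>"
    using assms by (auto simp: weak_labels_def)
  then show ?thesis
  proof cases
    case (1 \<alpha> i \<beta>)
    then show ?thesis
      by (intro exI[of _ "(to_ac \<alpha>, i, to_ac \<beta>)"]) (simp add: mpoly_eval_add mpoly_eval_mult)
  next
    case (2 \<beta>)
    then show ?thesis
      by (intro exI[of _ "(0, 0, to_ac \<beta>)"]) simp
  qed
qed

text \<open>Evaluation at points over the algebraic closure turns a weak program over the field into
  a matrix product for \<open>target\<close>, which is impossible there.\<close>

lemma target_not_in_VP2_weak: "(\<lambda>_. target_mpoly :: 'a::field mpoly) \<notin> VP2_weak"
proof
  assume "(\<lambda>_. target_mpoly :: 'a mpoly) \<in> VP2_weak"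
  then obtain m and A :: "'a abp" where A: "is_abp (weak_labels m) A" "abp_width A \<le> 2"
    and val: "abp_value A = target_mpoly"
    unfolding VP2_weak_def abp_class_def by blast
  interpret weak_abp A "weak_labels m" to_ac
    by (intro weak_abp.intro layered_abp.intro semiring_hom_to_ac weak_abp_axioms.intro A weak_label_eval)
  obtain Ms r c where "\<And>p. target p = dot (row_at p Ms r) (c :: 'a alg_closure \<times> 'a alg_closure)"
    using abp_value_program unfolding val mpoly_eval_target_mpoly by blast
  then show False
    by (rule target_no_weak_program)
qed

theorem theorem5p3:
  shows "(VP2_weak :: (nat \<Rightarrow> 'a::field mpoly) set) \<subset> VP2_gen"
proof
  show "(VP2_weak :: (nat \<Rightarrow> 'a mpoly) set) \<subseteq> VP2_gen"
    unfolding VP2_weak_def VP2_gen_def by (intro abp_class_mono weak_labels_subset)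
  show "(VP2_weak :: (nat \<Rightarrow> 'a mpoly) set) \<noteq> VP2_gen"
    using target_in_VP2_gen target_not_in_VP2_weak by metis
qed

end
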